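(* Let $(Q,N,C_1,C_2,\dots)$ be a nonnegative random vector with $N\in\{0,1,2,\dots\}\cup\{\infty\}$ and $P(Q>0)>0$, and let $\{W_n\}_{n\ge0}$ be the associated process on the weighted branching tree (see context). For $\beta > 1$ suppose $E[Q^\beta]< \infty$, $E\left[ \left( \sum_{i=1}^N C_i \right)^\beta \right] < \infty$, and $\rho \vee \rho_\beta < 1$, where $\rho_\beta=E\left[\sum_{i=1}^N C_i^\beta\right]$ and $\rho=\rho_1=E\left[\sum_{i=1}^N C_i\right]$. Then there exists a constant $K_\beta > 0$ such that for all $n \geq 0$, $$E[ W_n^\beta ] \leq K_\beta ( \rho \vee \rho_\beta )^{n}.$$
   Context: Let $U=\bigcup_{k=0}^\infty \{1,2,3,\dots\}^k$, with $\{1,2,\dots\}^0=\{\emptyset\}$; $(\mathbf{i},j)$ denotes concatenation, $(\emptyset,j)=j$. Let $\{(Q_{\mathbf i}, N_{\mathbf i}, C_{(\mathbf i,1)}, C_{(\mathbf i,2)},\dots)\}_{\mathbf i\in U}$ be iid copies of $(Q,N,C_1,C_2,\dots)$, the copy at the root $\emptyset$ being $(Q,N,C_1,C_2,\dots)$ itself. Put $A_0=\{\emptyset\}$ and $A_n=\{(i_1,\dots,i_n)\in U: (i_1,\dots,i_{n-1})\in A_{n-1},\ 1\le i_n\le N_{(i_1,\dots,i_{n-1})}\}$ for $n\ge1$. The weights are $\Pi_\emptyset=1$ and $\Pi_{(i_1,\dots,i_n)}=C_{(i_1,\dots,i_n)}\Pi_{(i_1,\dots,i_{n-1})}$. Define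 $W_n=\sum_{\mathbf i\in A_n}Q_{\mathbf i}\Pi_{\mathbf i}$, $n\ge0$ (so $W_0=Q$). $a\vee b$ denotes $\max\{a,b\}$. *)

theory Defs
  imports "HOL-Probability.Probability"
begin

text \<open>
  Nodes of the tree are lists over \<open>{1, 2, 3, ...}\<close>; the empty list is the root and
  \<open>xs @ [j]\<close> is the \<open>j\<close>-th child of \<open>xs\<close>.
\<close>

definition nodes :: "nat list set" where
  "nodes = lists {1..}"

text \<open>
  The vector \<open>(Q\<^sub>i, N\<^sub>i, C\<^sub>(\<^sub>i\<^sub>,\<^sub>1\<^sub>), C\<^sub>(\<^sub>i\<^sub>,\<^sub>2\<^sub>), ...)\<close> at a node. The weight \<open>C xs\<close> is attached
  to the node \<open>xs\<close> itself, so it belongs to the vector of the parent of \<open>xs\<close>, and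
  \<open>C []\<close> is never used. The type \<^typ>\<open>enat\<close> is countable, so its \<open>\<sigma>\<close>-algebra is the discrete one.
\<close>

definition node_vec ::
  "(nat list \<Rightarrow> 'a \<Rightarrow> real) \<Rightarrow> (nat list \<Rightarrow> 'a \<Rightarrow> enat) \<Rightarrow> (nat list \<Rightarrow> 'a \<Rightarrow> real) \<Rightarrow>
    nat list \<Rightarrow> 'a \<Rightarrow> real \<times> enat \<times> (nat \<Rightarrow> real)" where
  "node_vec Q N C xs \<omega> = (Q xs \<omega>, N xs \<omega>, \<lambda>j\<in>{1..}. C (xs @ [j]) \<omega>)"

definition vec_measure :: "(real \<times> enat \<times> (nat \<Rightarrow> real)) measure" where
  "vec_measure = borel \<Otimes>\<^sub>M count_space UNIV \<Otimes>\<^sub>M (\<Pi>\<^sub>M j\<in>{1..}. borel)"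

text \<open>
  The generic vector is the one at the root; the vectors at the other nodes are iid copies,
  hence they inherit its (almost sure) nonnegativity. Independence includes
  measurability of each \<open>node_vec\<close>.
\<close>

locale weighted_branching = prob_space M
  for M :: "'a measure"
  and Q :: "nat list \<Rightarrow> 'a \<Rightarrow> real"
  and N :: "nat list \<Rightarrow> 'a \<Rightarrow> enat"
  and C :: "nat list \<Rightarrow> 'a \<Rightarrow> real" +
  assumes indep: "indep_vars (\<lambda>_. vec_measure) (node_vec Q N C) nodes"
    and ident: "\<And>xs. xs \<in> nodes \<Longrightarrow>
      distr M vec_measure (node_vec Q N C xs) = distr M vec_measure (node_vec Q N C [])"
    and nonneg_Q: "AE \<omega> in M. 0 \<le> Q [] \<omega>"
    and nonneg_C: "\<And>j. 1 \<le> j \<Longrightarrow> AE \<omega> in M. 0 \<le> C [j] \<omega>"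

primrec generation :: "(nat list \<Rightarrow> 'a \<Rightarrow> enat) \<Rightarrow> nat \<Rightarrow> 'a \<Rightarrow> nat list set" where
  "generation N 0 \<omega> = {[]}"
| "generation N (Suc n) \<omega> =
    {xs @ [j] | xs j. xs \<in> generation N n \<omega> \<and> 1 \<le> j \<and> enat j \<le> N xs \<omega>}"

fun weight :: "(nat list \<Rightarrow> 'a \<Rightarrow> real) \<Rightarrow> nat list \<Rightarrow> 'a \<Rightarrow> real" where
  "weight C xs \<omega> = (if xs = [] then 1 else C xs \<omega> * weight C (butlast xs) \<omega>)"

declare weight.simps [simp del]

lemma weight_Nil [simp]: "weight C [] \<omega> = 1"
  by (simp add: weight.simps)

lemma weight_snoc [simp]: "weight C (xs @ [j]) \<omega> = C (xs @ [j]) \<omega> * weight C xs \<omega>"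
  by (subst weight.simps) simp

text \<open>
  All sums have nonnegative terms, and possibly infinitely many of them; they are taken in
  \<^typ>\<open>ennreal\<close>, where they always exist. Accordingly, expectations are
  \<^typ>\<open>ennreal\<close>-valued integrals.
\<close>

definition branching_sum ::
  "(nat list \<Rightarrow> 'a \<Rightarrow> real) \<Rightarrow> (nat list \<Rightarrow> 'a \<Rightarrow> enat) \<Rightarrow> (nat list \<Rightarrow> 'a \<Rightarrow> real) \<Rightarrow>
    nat \<Rightarrow> 'a \<Rightarrow> ennreal" where
  "branching_sum Q N C n \<omega> =
    (\<Sum>\<^sub>\<infinity>xs\<in>generation N n \<omega>. ennreal (Q xs \<omega> * weight C xs \<omega>))"

lemma branching_sum_0: "branching_sum Q N C 0 \<omega> = ennreal (Q [] \<omega>)"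
  by (simp add: branching_sum_def)

text \<open>Powers of extended nonnegative reals with a positive real exponent.\<close>

definition ennreal_powr :: "ennreal \<Rightarrow> real \<Rightarrow> ennreal" where
  "ennreal_powr x b = (if x = \<top> then \<top> else ennreal (enn2real x powr b))"

text \<open>Indices \<open>1 \<le> i \<le> N\<close>; all positive naturals if \<open>N = \<infinity>\<close>.\<close>

definition upto_enat :: "enat \<Rightarrow> nat set" where
  "upto_enat m = {i. 1 \<le> i \<and> enat i \<le> m}"

definition rho ::
  "'a measure \<Rightarrow> (nat list \<Rightarrow> 'a \<Rightarrow> enat) \<Rightarrow> (nat list \<Rightarrow> 'a \<Rightarrow> real) \<Rightarrow> real \<Rightarrow> ennreal" where
  "rho M N C b = (\<integral>\<^sup>+\<omega>. (\<Sum>\<^sub>\<infinity>i\<in>upto_enat (N [] \<omega>). ennreal (C [i] \<omega> powr b)) \<partial>M)"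

end

theory Submission
  imports Defs
begin

text \<open>
  Put \<open>r = max \<rho> \<rho>\<^sub>\<beta>\<close>. Splitting the tree at the root gives \<open>W\<^sub>n\<^sub>+\<^sub>1 = (\<Sum>i\<le>N. C\<^sub>i W\<^sub>n\<^sup>(\<^sup>i\<^sup>))\<close>, where the
  \<open>W\<^sub>n\<^sup>(\<^sup>i\<^sup>)\<close> are the branching sums of the subtrees: they are independent copies of \<open>W\<^sub>n\<close>, and
  independent of the vector at the root. Given the root vector, \<open>W\<^sub>n\<^sub>+\<^sub>1\<close> is a weighted sum of
  iid variables with constant weights \<open>c\<^sub>i\<close>.

  For such a sum, the moment of order \<open>1 + b\<close> is at most the diagonal part
  \<open>(\<Sum>i. c\<^sub>i\<^sup>1\<^sup>+\<^sup>b) E[Y\<^sup>1\<^sup>+\<^sup>b]\<close>, with constant exactly \<open>1\<close>, plus a constant multiple of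
  \<open>(\<Sum>i. c\<^sub>i)\<^sup>1\<^sup>+\<^sup>b\<close> times a product of lower moments: \<open>E[Y] E[Y]\<^sup>b\<close> if \<open>b \<le> 1\<close>
  (\<open>nn_integral_weighted_sum_powr_le_concave\<close>) and \<open>E[Y] E[Y\<^sup>b]\<close> if \<open>b > 1\<close>
  (\<open>nn_integral_weighted_sum_powr_le_convex\<close>). Integrating over the root vector
  (\<open>moment_Suc_le\<close>) turns the diagonal part into \<open>\<rho>\<^sub>1\<^sub>+\<^sub>b E[W\<^sub>n\<^sup>1\<^sup>+\<^sup>b]\<close>, and
  \<open>\<rho>\<^sub>1\<^sub>+\<^sub>b \<le> r\<close> for \<open>1 + b \<le> \<beta>\<close> by convexity in the exponent (\<open>rho_le_max\<close>).

  Since lower moments already decay like \<open>r\<^sup>n\<close>, a product of two of them is smaller than \<open>r\<^sup>n\<close> by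
  another geometric factor, and such a perturbation does not change the rate of the linear
  recursion (\<open>geometric_recursion_bound\<close>). An induction that lowers the exponent by \<open>1\<close> in each
  step reaches \<open>\<beta>\<close> (\<open>moment_geometric_decay\<close>).
\<close>

section \<open>Powers of extended nonnegative reals\<close>

lemma ennreal_powr_ennreal [simp]: "0 \<le> x \<Longrightarrow> ennreal_powr (ennreal x) b = ennreal (x powr b)"
  by (simp add: ennreal_powr_def)

lemma ennreal_powr_top [simp]: "ennreal_powr \<top> b = \<top>"
  by (simp add: ennreal_powr_def)

lemma ennreal_powr_0 [simp]: "ennreal_powr 0 b = 0"
  by (simp add: ennreal_powr_def)

lemma ennreal_powr_1 [simp]: "ennreal_powr x 1 = x"
  by (cases x) auto

lemma ennreal_powr_eq_0_iff [simp]: "ennreal_powr x b = 0 \<longleftrightarrow> x = 0"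
  by (cases x) (auto simp: less_le)

lemma ennreal_powr_eq_top_iff [simp]: "ennreal_powr x b = \<top> \<longleftrightarrow> x = \<top>"
  by (cases x) auto

lemma ennreal_powr_mono: "0 \<le> b \<Longrightarrow> x \<le> y \<Longrightarrow> ennreal_powr x b \<le> ennreal_powr y b"
  by (cases x; cases y) (auto intro!: ennreal_leI powr_mono2 simp: top_unique)

lemma borel_measurable_ennreal_powr [measurable (raw)]:
  assumes [measurable]: "f \<in> borel_measurable M"
  shows "(\<lambda>x. ennreal_powr (f x) b) \<in> borel_measurable M"
  unfolding ennreal_powr_def by measurable

lemma ennreal_powr_mult: "ennreal_powr (x * y) b = ennreal_powr x b * ennreal_powr y b"
  by (cases x; cases y; cases "x = 0"; cases "y = 0")
    (auto simp: powr_mult ennreal_mult_top ennreal_top_mult ennreal_mult[symmetric])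

lemma ennreal_powr_add: "ennreal_powr x (a + b) = ennreal_powr x a * ennreal_powr x b"
  by (cases x) (auto simp: powr_add ennreal_mult)

lemma ennreal_powr_powr: "ennreal_powr (ennreal_powr x a) b = ennreal_powr x (a * b)"
  by (cases x) (auto simp: powr_powr)

lemma mult_ennreal_powr: "x * ennreal_powr x b = ennreal_powr x (1 + b)"
  by (simp add: ennreal_powr_add)

text \<open>
  By concavity, \<open>z \<mapsto> z\<^sup>a\<close> lies below its tangent at \<open>t\<close>. As the bound is affine in \<open>z\<close>, it can be
  summed and integrated; the best \<open>t\<close> is chosen afterwards.
\<close>

lemma powr_le_tangent:
  fixes t z :: real
  assumes "0 < t" "0 \<le> z" "0 < a" "a < 1"
  shows "z powr a \<le> (1 - a) * t powr a + a * t powr (a - 1) * z"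
proof (cases "z = 0")
  case False
  have "t powr (1 - a) * z powr a \<le> (1 - a) * t + a * z"
    using Youngs_inequality_0[of "1 - a" a t z] assms False by simp
  then have "t powr (a - 1) * (t powr (1 - a) * z powr a) \<le> t powr (a - 1) * ((1 - a) * t + a * z)"
    by (intro mult_left_mono) auto
  moreover have "t powr (a - 1) * (t powr (1 - a) * z powr a) = z powr a"
    using assms by (simp flip: mult.assoc powr_add)
  moreover have "t powr (a - 1) * t = t powr a"
    using assms by (simp add: mult.commute powr_mult_base)
  then have "t powr (a - 1) * ((1 - a) * t + a * z) = (1 - a) * t powr a + a * t powr (a - 1) * z"
    by (simp only: distrib_left mult.left_commute[of _ "1 - a"]) (simp add: ac_simps)
  ultimately show ?thesis by simp
qed (use assms in auto)

lemma ennreal_powr_le_tangent: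
  assumes "0 < t" "0 < a" "a < 1"
  shows "ennreal_powr z a \<le> ennreal ((1 - a) * t powr a) + ennreal (a * t powr (a - 1)) * z"
  using assms powr_le_tangent[of t _ a]
  by (cases z) (auto simp: ennreal_mult_top ennreal_plus[symmetric] ennreal_mult[symmetric]
      intro!: ennreal_leI simp del: ennreal_plus)

lemma ennreal_powr_le_1_plus:
  assumes "0 \<le> a" "a \<le> b"
  shows "ennreal_powr x a \<le> 1 + ennreal_powr x b"
proof (cases "x \<le> 1")
  case True
  then have "ennreal_powr x a \<le> ennreal_powr 1 a"
    using assms by (intro ennreal_powr_mono)
  also have "ennreal_powr 1 a = 1"
    using ennreal_powr_ennreal[of 1 a] by simp
  finally show ?thesis by (simp add: add_increasing2)
next
  case False
  then have "ennreal_powr x a \<le> ennreal_powr x b"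
    using assms by (cases x) (auto intro!: ennreal_leI powr_mono simp flip: ennreal_1)
  then show ?thesis by (simp add: add_increasing)
qed

text \<open>
  Powers are log-convex in the exponent; only the weaker convexity along the segment from \<open>1\<close> to
  \<open>1 + b\<close> is recorded, since it passes to \<open>\<rho>\<close> by linearity. It is the tangent at \<open>1\<close>, applied to \<open>x\<^sup>b\<close>.
\<close>

lemma ennreal_powr_le_interpolate:
  assumes a: "0 \<le> a" "a \<le> 1"
  shows "ennreal_powr x (1 + a * b) \<le> ennreal (1 - a) * x + ennreal a * ennreal_powr x (1 + b)"
proof -
  consider "a = 0" | "a = 1" | "0 < a" "a < 1" using a by linarith
  then show ?thesis
  proof cases
    case 3
    have "x * ennreal_powr (ennreal_powr x b) a \<le> x * (ennreal (1 - a) + ennreal a * ennreal_powr x b)"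
      using ennreal_powr_le_tangent[of 1 a "ennreal_powr x b"] 3 by (intro mult_left_mono) auto
    also have "\<dots> = ennreal (1 - a) * x + ennreal a * (x * ennreal_powr x b)"
      by (simp only: distrib_left ac_simps)
    finally show ?thesis
      by (simp only: mult_ennreal_powr ennreal_powr_powr mult.commute[of b])
  qed simp_all
qed

text \<open>
  Hoelder's inequality for the measure with density \<open>f\<close>; equivalently, Jensen's inequality for the
  concave function \<open>z \<mapsto> z\<^sup>a\<close>. When both integrals on the right are positive and finite, the tangent
  at their ratio gives the bound exactly.
\<close>

lemma nn_integral_mult_powr_le:
  assumes [measurable]: "f \<in> borel_measurable M" "Z \<in> borel_measurable M" and a: "0 < a" "a < 1"
  shows "(\<integral>\<^sup>+x. f x * ennreal_powr (Z x) a \<partial>M)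
    \<le> ennreal_powr (\<integral>\<^sup>+x. f x \<partial>M) (1 - a) * ennreal_powr (\<integral>\<^sup>+x. f x * Z x \<partial>M) a"
    (is "?L \<le> ennreal_powr ?A _ * ennreal_powr ?B _")
proof -
  consider "?A = 0 \<or> ?B = 0" | "?A \<noteq> 0" "?B \<noteq> 0" "?A = \<top> \<or> ?B = \<top>"
    | A B where "?A = ennreal A" "?B = ennreal B" "0 < A" "0 < B"
    by (cases ?A; cases ?B) (auto simp: less_le)
  then show ?thesis
  proof cases
    \<comment> \<open>Vanishing of either integral forces \<open>f x * Z x = 0\<close> almost everywhere, and then the
      integrand on the left vanishes as well.\<close>
    case 1
    then have "AE x in M. f x * ennreal_powr (Z x) a = 0"
      by (auto simp: nn_integral_0_iff_AE)
    then have "?L = (\<integral>\<^sup>+x. 0 \<partial>M)"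
      by (rule nn_integral_cong_AE)
    then show ?thesis by simp
  next
    case 2
    then show ?thesis by (auto simp: ennreal_mult_eq_top_iff top_unique ennreal_top_mult ennreal_mult_top)
  next
    case (3 A B)
    define t where "t = B / A"
    have t: "0 < t" using 3 by (simp add: t_def)
    have "?L \<le> (\<integral>\<^sup>+x. ennreal ((1 - a) * t powr a) * f x + ennreal (a * t powr (a - 1)) * (f x * Z x) \<partial>M)"
    proof (rule nn_integral_mono)
      fix x
      have "f x * ennreal_powr (Z x) a
        \<le> f x * (ennreal ((1 - a) * t powr a) + ennreal (a * t powr (a - 1)) * Z x)"
        by (intro mult_left_mono ennreal_powr_le_tangent t a) auto
      then show "f x * ennreal_powr (Z x) a
        \<le> ennreal ((1 - a) * t powr a) * f x + ennreal (a * t powr (a - 1)) * (f x * Z x)"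
        by (simp add: algebra_simps)
    qed
    also have "\<dots> = ennreal ((1 - a) * t powr a) * ?A + ennreal (a * t powr (a - 1)) * ?B"
      by (simp add: nn_integral_add nn_integral_cmult)
    also have "\<dots> = ennreal ((1 - a) * t powr a * A + a * t powr (a - 1) * B)"
      using a 3 by (simp add: ennreal_mult)
    also have "(1 - a) * t powr a * A + a * t powr (a - 1) * B = A powr (1 - a) * B powr a"
      using 3 a by (simp add: t_def powr_divide powr_diff field_simps)
    also have "ennreal \<dots> = ennreal_powr ?A (1 - a) * ennreal_powr ?B a"
      using 3 by (simp add: ennreal_mult)
    finally show ?thesis .
  qed
qed

text \<open>
  Jensen's inequality for the convex function \<open>y \<mapsto> y\<^sup>b\<close> and the weights \<open>c\<close>: the previous inequality
  for counting measure, the exponent \<open>1/b\<close> and \<open>Z = y\<^sup>b\<close>.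
\<close>

lemma suminf_mult_powr_le:
  fixes c y :: "nat \<Rightarrow> ennreal"
  assumes b: "1 < b"
  shows "ennreal_powr (\<Sum>j. c j * y j) b \<le> ennreal_powr (\<Sum>j. c j) (b - 1) * (\<Sum>j. c j * ennreal_powr (y j) b)"
proof -
  have "(\<Sum>j. c j * y j) \<le> ennreal_powr (\<Sum>j. c j) (1 - 1/b) * ennreal_powr (\<Sum>j. c j * ennreal_powr (y j) b) (1/b)"
    using nn_integral_mult_powr_le[of c "count_space UNIV" "\<lambda>j. ennreal_powr (y j) b" "1/b"] b
    by (simp add: ennreal_powr_powr nn_integral_count_space_nat)
  then have "ennreal_powr (\<Sum>j. c j * y j) b \<le>
    ennreal_powr (ennreal_powr (\<Sum>j. c j) (1 - 1/b) * ennreal_powr (\<Sum>j. c j * ennreal_powr (y j) b) (1/b)) b"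
    using b by (intro ennreal_powr_mono) auto
  also have "\<dots> = ennreal_powr (\<Sum>j. c j) (b - 1) * (\<Sum>j. c j * ennreal_powr (y j) b)"
    using b by (simp add: ennreal_powr_mult ennreal_powr_powr left_diff_distrib)
  finally show ?thesis .
qed

lemma ennreal_powr_subadditive:
  assumes "0 < b" "b \<le> 1"
  shows "ennreal_powr (x + y) b \<le> ennreal_powr x b + ennreal_powr y b"
proof (cases x; cases y)
  fix u v assume uv: "x = ennreal u" "0 \<le> u" "y = ennreal v" "0 \<le> v"
  have "(u + v) powr b \<le> u powr b + v powr b"
  proof (cases "u + v = 0")
    case False
    \<comment> \<open>The exponent \<open>b - 1\<close> is not positive, so replacing \<open>u + v\<close> by a smaller \<open>w\<close> increases the power.\<close>
    have *: "w * (u + v) powr (b - 1) \<le> w powr b" if "0 \<le> w" "w \<le> u + v" for w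
    proof (cases "w = 0")
      case False
      then have "w * (u + v) powr (b - 1) \<le> w * w powr (b - 1)"
        using that assms by (intro mult_left_mono powr_mono2') auto
      then show ?thesis using that False by (simp add: powr_mult_base)
    qed auto
    have "(u + v) powr b = u * (u + v) powr (b - 1) + v * (u + v) powr (b - 1)"
      using uv False by (simp add: powr_mult_base flip: distrib_right)
    also have "\<dots> \<le> u powr b + v powr b"
      using uv by (intro add_mono *) auto
    finally show ?thesis .
  qed auto
  then show ?thesis using uv by (simp add: ennreal_leI flip: ennreal_plus)
qed auto

text \<open>
  The coefficient of the leading term \<open>x\<^sup>b\<close> is exactly \<open>1\<close>. A coefficient \<open>1 + \<epsilon>\<close> would multiply the
  decay rate of the moments of the branching sums at each generation. The mean value theorem
  bounds the increment by \<open>b y (x + y)\<^sup>b\<^sup>-\<^sup>1\<close>, and \<open>x + y \<le> 2 max x y\<close>.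
\<close>

lemma powr_add_le_expand:
  fixes x y :: real
  assumes "1 < b" "0 \<le> x" "0 \<le> y"
  shows "(x + y) powr b \<le> x powr b + b * 2 powr (b - 1) * (x powr (b - 1) * y + y powr b)"
proof -
  consider "x = 0" | "y = 0" | "0 < x" "0 < y" using assms by linarith
  then show ?thesis
  proof cases
    case 1
    have "1 \<le> b * 2 powr (b - 1)"
      using assms mult_mono[of 1 b 1 "2 powr (b - 1)"] by (simp add: ge_one_powr_ge_zero)
    then have "1 * y powr b \<le> b * 2 powr (b - 1) * y powr b"
      by (intro mult_right_mono) auto
    with 1 show ?thesis using assms by simp
  next
    case 3
    obtain z where z: "x < z" "z < x + y" "(x + y) powr b - x powr b = (x + y - x) * (b * z powr (b - 1))"
    proof -
      have "\<exists>z. x < z \<and> z < x + y \<and> (x + y) powr b - x powr b = (x + y - x) * (b * z powr (b - 1))"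
        using 3 by (intro MVT2) (auto intro!: derivative_eq_intros simp: powr_diff)
      then show ?thesis using that by blast
    qed
    have "z powr (b - 1) \<le> (2 * max x y) powr (b - 1)"
      using z 3 assms by (intro powr_mono2) auto
    also have "\<dots> = 2 powr (b - 1) * max x y powr (b - 1)"
      using 3 by (simp add: powr_mult)
    also have "\<dots> \<le> 2 powr (b - 1) * (x powr (b - 1) + y powr (b - 1))"
      by (intro mult_left_mono) (auto simp: max_def)
    finally have "y * (b * z powr (b - 1)) \<le> y * (b * (2 powr (b - 1) * (x powr (b - 1) + y powr (b - 1))))"
      using 3 assms by (intro mult_left_mono) auto
    also have "\<dots> = b * 2 powr (b - 1) * (x powr (b - 1) * y + y powr b)"
      using 3 by (simp add: powr_diff field_simps)
    finally show ?thesis using z(3) by simp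
  qed (use assms in auto)
qed

lemma ennreal_powr_add_le_expand:
  assumes "1 < b"
  shows "ennreal_powr (x + y) b
    \<le> ennreal_powr x b + ennreal (b * 2 powr (b - 1)) * (ennreal_powr x (b - 1) * y + ennreal_powr y b)"
proof (cases x; cases y)
  fix u v assume uv: "x = ennreal u" "0 \<le> u" "y = ennreal v" "0 \<le> v"
  show ?thesis
    using powr_add_le_expand[OF assms, of u v] uv assms
    by (simp add: ennreal_leI flip: ennreal_plus ennreal_mult)
qed (use assms in \<open>auto simp: ennreal_mult_top ennreal_top_mult\<close>)

section \<open>Moments of weighted sums of pairwise independent variables\<close>

lemma suminf_eq_plus_others:
  fixes x :: "nat \<Rightarrow> ennreal"
  shows "(\<Sum>j. x j) = x i + (\<Sum>j. if j = i then 0 else x j)"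
proof -
  have "(\<Sum>j. x j) = (\<Sum>j. (if j = i then x i else 0) + (if j = i then 0 else x j))"
    by (intro suminf_cong) auto
  also have "\<dots> = (\<Sum>j. if j = i then x i else 0) + (\<Sum>j. if j = i then 0 else x j)"
    by (intro suminf_add[symmetric]) auto
  also have "(\<Sum>j. if j = i then x i else 0) = x i"
    using suminf_finite[of "{i}" "\<lambda>j. if j = i then x i else 0"] by simp
  finally show ?thesis .
qed

lemma (in prob_space) nn_integral_mult_indep:
  fixes X Y :: "'a \<Rightarrow> ennreal"
  assumes "indep_var borel X borel Y"
  shows "(\<integral>\<^sup>+\<omega>. X \<omega> * Y \<omega> \<partial>M) = (\<integral>\<^sup>+\<omega>. X \<omega> \<partial>M) * (\<integral>\<^sup>+\<omega>. Y \<omega> \<partial>M)"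
proof -
  have "case_bool borel borel = (\<lambda>_. borel :: ennreal measure)"
    by (auto simp: fun_eq_iff split: bool.split)
  then have "indep_vars (\<lambda>_. borel) (case_bool X Y) UNIV"
    using assms by (simp add: indep_var_def)
  from indep_vars_nn_integral[OF _ this] show ?thesis
    by (simp add: UNIV_bool mult.commute)
qed

text \<open>
  The estimate for all cross terms: pairwise independence factorises each summand, and dropping the
  condition \<open>j \<noteq> i\<close> only enlarges the sum of the weights.
\<close>

lemma (in prob_space) nn_integral_mult_others_le:
  fixes Y :: "nat \<Rightarrow> 'a \<Rightarrow> ennreal" and c :: "nat \<Rightarrow> ennreal"
  assumes indep: "\<And>i j. i \<noteq> j \<Longrightarrow> indep_var borel (Y i) borel (Y j)"
    and [measurable]: "\<And>i. Y i \<in> borel_measurable M"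
    and [measurable]: "g \<in> borel_measurable borel" "h \<in> borel_measurable borel"
    and u: "\<And>j. (\<integral>\<^sup>+\<omega>. h (Y j \<omega>) \<partial>M) = u"
  shows "(\<integral>\<^sup>+\<omega>. g (Y i \<omega>) * (\<Sum>j. if j = i then 0 else c j * h (Y j \<omega>)) \<partial>M)
    \<le> (\<integral>\<^sup>+\<omega>. g (Y i \<omega>) \<partial>M) * ((\<Sum>j. c j) * u)"
proof -
  have "(\<integral>\<^sup>+\<omega>. g (Y i \<omega>) * (\<Sum>j. if j = i then 0 else c j * h (Y j \<omega>)) \<partial>M)
    = (\<integral>\<^sup>+\<omega>. (\<Sum>j. g (Y i \<omega>) * (if j = i then 0 else c j * h (Y j \<omega>))) \<partial>M)"
    by simp
  also have "\<dots> = (\<Sum>j. \<integral>\<^sup>+\<omega>. g (Y i \<omega>) * (if j = i then 0 else c j * h (Y j \<omega>)) \<partial>M)"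
    by (intro nn_integral_suminf) measurable
  also have "\<dots> \<le> (\<Sum>j. (\<integral>\<^sup>+\<omega>. g (Y i \<omega>) \<partial>M) * (c j * u))"
  proof (intro suminf_le allI)
    fix j
    show "(\<integral>\<^sup>+\<omega>. g (Y i \<omega>) * (if j = i then 0 else c j * h (Y j \<omega>)) \<partial>M)
      \<le> (\<integral>\<^sup>+\<omega>. g (Y i \<omega>) \<partial>M) * (c j * u)"
    proof (cases "j = i")
      case False
      then have "indep_var borel (g \<circ> Y i) borel (h \<circ> Y j)"
        by (intro indep_var_compose[OF indep]) auto
      then have "(\<integral>\<^sup>+\<omega>. g (Y i \<omega>) * h (Y j \<omega>) \<partial>M) = (\<integral>\<^sup>+\<omega>. g (Y i \<omega>) \<partial>M) * u"
        using nn_integral_mult_indep[of "g \<circ> Y i" "h \<circ> Y j"] u[of j] by simp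
      then show ?thesis
        using False by (simp add: mult.left_commute[of _ "c j"] nn_integral_cmult)
    qed simp
  qed auto
  also have "\<dots> = (\<integral>\<^sup>+\<omega>. g (Y i \<omega>) \<partial>M) * ((\<Sum>j. c j) * u)"
    by simp
  finally show ?thesis .
qed

text \<open>
  Splitting off one factor of the sum leaves the power \<open>b\<close> of \<open>x i\<close> plus the remaining summands. This
  separates the diagonal terms \<open>(x i)\<^sup>1\<^sup>+\<^sup>b\<close> from the cross terms, for infinite sums and
  non-integer exponents.
\<close>

lemma suminf_powr_1_plus:
  fixes x :: "nat \<Rightarrow> ennreal"
  shows "ennreal_powr (\<Sum>i. x i) (1 + b) = (\<Sum>i. x i * ennreal_powr (x i + (\<Sum>j. if j = i then 0 else x j)) b)"
  by (simp add: ennreal_powr_add flip: suminf_eq_plus_others)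

text \<open>
  For \<open>b \<le> 1\<close> the power \<open>b\<close> is subadditive, so it remains to estimate \<open>E[Y\<^sub>i R\<^sub>i\<^sup>b]\<close>, where \<open>R\<^sub>i\<close> is the
  weighted sum of the variables other than \<open>Y\<^sub>i\<close>. Hoelder's inequality with density \<open>Y\<^sub>i\<close> moves the
  power \<open>b\<close> outside the expectation, and there only \<open>E[Y\<^sub>i R\<^sub>i]\<close> is needed, which pairwise
  independence controls.
\<close>

lemma (in prob_space) nn_integral_weighted_sum_powr_le_concave:
  fixes Y :: "nat \<Rightarrow> 'a \<Rightarrow> ennreal" and c :: "nat \<Rightarrow> ennreal"
  assumes indep: "\<And>i j. i \<noteq> j \<Longrightarrow> indep_var borel (Y i) borel (Y j)"
    and Y [measurable]: "\<And>i. Y i \<in> borel_measurable M"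
    and b: "0 < b" "b \<le> 1"
    and m: "\<And>i. (\<integral>\<^sup>+\<omega>. Y i \<omega> \<partial>M) = m"
    and v: "\<And>i. (\<integral>\<^sup>+\<omega>. ennreal_powr (Y i \<omega>) (1 + b) \<partial>M) = v"
  shows "(\<integral>\<^sup>+\<omega>. ennreal_powr (\<Sum>i. c i * Y i \<omega>) (1 + b) \<partial>M)
    \<le> (\<Sum>i. ennreal_powr (c i) (1 + b)) * v
      + ennreal_powr (\<Sum>i. c i) (1 + b) * (m * ennreal_powr m b)"
proof -
  define s where "s = (\<Sum>i. c i)"
  define R where "R i \<omega> = (\<Sum>j. if j = i then 0 else c j * Y j \<omega>)" for i \<omega>
  have [measurable]: "R i \<in> borel_measurable M" for i
    unfolding R_def by measurable
  have YR: "(\<integral>\<^sup>+\<omega>. Y i \<omega> * R i \<omega> \<partial>M) \<le> m * (s * m)" for i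
    using nn_integral_mult_others_le[where g = "\<lambda>x. x" and h = "\<lambda>x. x" and i = i and c = c, OF indep Y _ _ m]
    by (simp add: R_def s_def m)
  have YRb: "(\<integral>\<^sup>+\<omega>. Y i \<omega> * ennreal_powr (R i \<omega>) b \<partial>M) \<le> ennreal_powr s b * (m * ennreal_powr m b)" for i
  proof (cases "b = 1")
    case True
    then show ?thesis using YR[of i] by (simp add: ac_simps)
  next
    case False
    have "(\<integral>\<^sup>+\<omega>. Y i \<omega> * ennreal_powr (R i \<omega>) b \<partial>M)
      \<le> ennreal_powr m (1 - b) * ennreal_powr (\<integral>\<^sup>+\<omega>. Y i \<omega> * R i \<omega> \<partial>M) b"
      using nn_integral_mult_powr_le[of "Y i" M "R i" b] False b m by simp
    also have "\<dots> \<le> ennreal_powr m (1 - b) * ennreal_powr (m * (s * m)) b"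
      using b by (intro mult_left_mono ennreal_powr_mono YR) auto
    also have "\<dots> = ennreal_powr m ((1 - b) + b) * (ennreal_powr s b * ennreal_powr m b)"
      by (simp only: ennreal_powr_mult ennreal_powr_add ac_simps)
    finally show ?thesis by (simp add: ac_simps)
  qed
  have "(\<integral>\<^sup>+\<omega>. ennreal_powr (\<Sum>i. c i * Y i \<omega>) (1 + b) \<partial>M)
    \<le> (\<integral>\<^sup>+\<omega>. (\<Sum>i. ennreal_powr (c i) (1 + b) * ennreal_powr (Y i \<omega>) (1 + b)
        + c i * (Y i \<omega> * ennreal_powr (R i \<omega>) b)) \<partial>M)"
  proof (intro nn_integral_mono, subst suminf_powr_1_plus, intro suminf_le allI)
    fix \<omega> i
    have "c i * Y i \<omega> * ennreal_powr (c i * Y i \<omega> + R i \<omega>) b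
      \<le> c i * Y i \<omega> * (ennreal_powr (c i * Y i \<omega>) b + ennreal_powr (R i \<omega>) b)"
      using b by (intro mult_left_mono ennreal_powr_subadditive) auto
    then show "c i * Y i \<omega> * ennreal_powr (c i * Y i \<omega> + (\<Sum>j. if j = i then 0 else c j * Y j \<omega>)) b
      \<le> ennreal_powr (c i) (1 + b) * ennreal_powr (Y i \<omega>) (1 + b)
        + c i * (Y i \<omega> * ennreal_powr (R i \<omega>) b)"
      by (simp add: R_def[symmetric] distrib_left mult_ennreal_powr mult.assoc flip: ennreal_powr_mult)
  qed auto
  also have "\<dots> = (\<Sum>i. ennreal_powr (c i) (1 + b) * v
      + c i * (\<integral>\<^sup>+\<omega>. Y i \<omega> * ennreal_powr (R i \<omega>) b \<partial>M))"
    by (simp add: nn_integral_suminf nn_integral_add nn_integral_cmult v)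
  also have "\<dots> \<le> (\<Sum>i. ennreal_powr (c i) (1 + b) * v
      + c i * (ennreal_powr s b * (m * ennreal_powr m b)))"
    by (intro suminf_le add_left_mono mult_left_mono YRb allI) auto
  also have "\<dots> = (\<Sum>i. ennreal_powr (c i) (1 + b)) * v + s * (ennreal_powr s b * (m * ennreal_powr m b))"
    by (simp add: suminf_add[symmetric] s_def)
  finally show ?thesis
    by (simp only: s_def ennreal_powr_add ennreal_powr_1 mult.assoc)
qed

text \<open>
  For \<open>b > 1\<close> the expansion of \<open>(x + y)\<^sup>b\<close> produces two kinds of cross terms, \<open>x\<^sub>i\<^sup>b R\<^sub>i\<close> and
  \<open>x\<^sub>i R\<^sub>i\<^sup>b\<close> with \<open>x\<^sub>i = c\<^sub>i Y\<^sub>i\<close>. The first is linear in \<open>R\<^sub>i\<close>; in the second, Jensen's inequality for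
  sums bounds \<open>R\<^sub>i\<^sup>b\<close> by a weighted sum of the \<open>Y\<^sub>j\<^sup>b\<close>. Both then involve only the moments of orders
  \<open>1\<close> and \<open>b\<close>, multiplied with each other.
\<close>

lemma (in prob_space) nn_integral_weighted_sum_powr_le_convex:
  fixes Y :: "nat \<Rightarrow> 'a \<Rightarrow> ennreal" and c :: "nat \<Rightarrow> ennreal"
  assumes indep: "\<And>i j. i \<noteq> j \<Longrightarrow> indep_var borel (Y i) borel (Y j)"
    and Y [measurable]: "\<And>i. Y i \<in> borel_measurable M"
    and b: "1 < b"
    and m: "\<And>i. (\<integral>\<^sup>+\<omega>. Y i \<omega> \<partial>M) = m"
    and u: "\<And>i. (\<integral>\<^sup>+\<omega>. ennreal_powr (Y i \<omega>) b \<partial>M) = u"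
    and v: "\<And>i. (\<integral>\<^sup>+\<omega>. ennreal_powr (Y i \<omega>) (1 + b) \<partial>M) = v"
  shows "(\<integral>\<^sup>+\<omega>. ennreal_powr (\<Sum>i. c i * Y i \<omega>) (1 + b) \<partial>M)
    \<le> (\<Sum>i. ennreal_powr (c i) (1 + b)) * v
      + ennreal (b * 2 powr b) * (ennreal_powr (\<Sum>i. c i) (1 + b) * (m * u))"
proof -
  define s where "s = (\<Sum>i. c i)"
  define \<kappa> where "\<kappa> = ennreal (b * 2 powr (b - 1))"
  define R where "R i \<omega> = (\<Sum>j. if j = i then 0 else c j * Y j \<omega>)" for i \<omega>
  define B where "B = ennreal_powr s b * (m * u)"
  have [measurable]: "R i \<in> borel_measurable M" for i
    unfolding R_def by measurable
  have sb: "s * ennreal_powr s (b - 1) = ennreal_powr s b"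
    by (simp add: mult_ennreal_powr)
  have c_le: "c i \<le> s" for i
    unfolding s_def using sum_le_suminf[of c "{i}"] by simp
  have YbR: "(\<integral>\<^sup>+\<omega>. ennreal_powr (c i * Y i \<omega>) b * R i \<omega> \<partial>M) \<le> c i * B" for i
  proof -
    have "(\<integral>\<^sup>+\<omega>. ennreal_powr (c i * Y i \<omega>) b * R i \<omega> \<partial>M)
      = ennreal_powr (c i) b * (\<integral>\<^sup>+\<omega>. ennreal_powr (Y i \<omega>) b * R i \<omega> \<partial>M)"
      by (simp add: ennreal_powr_mult mult.assoc nn_integral_cmult)
    also have "\<dots> \<le> (c i * ennreal_powr s (b - 1)) * (u * (s * m))"
    proof (intro mult_mono)
      have "ennreal_powr (c i) b = c i * ennreal_powr (c i) (b - 1)"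
        by (simp add: mult_ennreal_powr)
      also have "\<dots> \<le> c i * ennreal_powr s (b - 1)"
        using b by (intro mult_left_mono ennreal_powr_mono c_le) auto
      finally show "ennreal_powr (c i) b \<le> c i * ennreal_powr s (b - 1)" .
      show "(\<integral>\<^sup>+\<omega>. ennreal_powr (Y i \<omega>) b * R i \<omega> \<partial>M) \<le> u * (s * m)"
        unfolding R_def s_def u[of i, symmetric]
        by (rule nn_integral_mult_others_le[where g = "\<lambda>x. ennreal_powr x b" and h = "\<lambda>x. x", OF indep Y _ _ m])
          auto
    qed auto
    also have "\<dots> = c i * (s * ennreal_powr s (b - 1) * (m * u))"
      by (simp only: ac_simps)
    finally show ?thesis by (simp add: B_def sb)
  qed
  have YRb: "(\<integral>\<^sup>+\<omega>. c i * Y i \<omega> * ennreal_powr (R i \<omega>) b \<partial>M) \<le> c i * B" for i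
  proof -
    define R' where "R' \<omega> = (\<Sum>j. if j = i then 0 else c j * ennreal_powr (Y j \<omega>) b)" for \<omega>
    have [measurable]: "R' \<in> borel_measurable M"
      unfolding R'_def by measurable
    have R': "ennreal_powr (R i \<omega>) b \<le> ennreal_powr s (b - 1) * R' \<omega>" for \<omega>
    proof -
      let ?c = "\<lambda>j. if j = i then 0 else c j"
      have R_eq: "R i \<omega> = (\<Sum>j. ?c j * Y j \<omega>)"
        unfolding R_def by (intro suminf_cong) auto
      have R'_eq: "R' \<omega> = (\<Sum>j. ?c j * ennreal_powr (Y j \<omega>) b)"
        unfolding R'_def by (intro suminf_cong) auto
      have "ennreal_powr (R i \<omega>) b \<le> ennreal_powr (\<Sum>j. ?c j) (b - 1) * R' \<omega>"
        unfolding R_eq R'_eq by (rule suminf_mult_powr_le[OF b])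
      also have "\<dots> \<le> ennreal_powr s (b - 1) * R' \<omega>"
        using b unfolding s_def by (intro mult_right_mono ennreal_powr_mono suminf_le) auto
      finally show ?thesis .
    qed
    have "(\<integral>\<^sup>+\<omega>. c i * Y i \<omega> * ennreal_powr (R i \<omega>) b \<partial>M)
      \<le> (\<integral>\<^sup>+\<omega>. c i * Y i \<omega> * (ennreal_powr s (b - 1) * R' \<omega>) \<partial>M)"
      by (intro nn_integral_mono mult_left_mono R') auto
    also have "\<dots> = (\<integral>\<^sup>+\<omega>. (c i * ennreal_powr s (b - 1)) * (Y i \<omega> * R' \<omega>) \<partial>M)"
      by (simp add: ac_simps)
    also have "\<dots> = (c i * ennreal_powr s (b - 1)) * (\<integral>\<^sup>+\<omega>. Y i \<omega> * R' \<omega> \<partial>M)"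
      by (intro nn_integral_cmult) measurable
    also have "\<dots> \<le> (c i * ennreal_powr s (b - 1)) * (m * (s * u))"
      unfolding R'_def s_def m[of i, symmetric]
      by (intro mult_left_mono
          nn_integral_mult_others_le[where g = "\<lambda>x. x" and h = "\<lambda>x. ennreal_powr x b", OF indep Y _ _ u]) auto
    also have "\<dots> = c i * (s * ennreal_powr s (b - 1) * (m * u))"
      by (simp only: ac_simps)
    finally show ?thesis by (simp add: B_def sb)
  qed
  have "(\<integral>\<^sup>+\<omega>. ennreal_powr (\<Sum>i. c i * Y i \<omega>) (1 + b) \<partial>M)
    \<le> (\<integral>\<^sup>+\<omega>. (\<Sum>i. ennreal_powr (c i) (1 + b) * ennreal_powr (Y i \<omega>) (1 + b)
        + \<kappa> * (ennreal_powr (c i * Y i \<omega>) b * R i \<omega> + c i * Y i \<omega> * ennreal_powr (R i \<omega>) b)) \<partial>M)"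
  proof (intro nn_integral_mono, subst suminf_powr_1_plus, intro suminf_le allI)
    fix \<omega> i
    let ?x = "c i * Y i \<omega>"
    have "?x * ennreal_powr (?x + R i \<omega>) b
      \<le> ?x * (ennreal_powr ?x b + \<kappa> * (ennreal_powr ?x (b - 1) * R i \<omega> + ennreal_powr (R i \<omega>) b))"
      using ennreal_powr_add_le_expand[OF b] unfolding \<kappa>_def by (intro mult_left_mono) auto
    also have "\<dots> = ennreal_powr ?x (1 + b)
        + \<kappa> * ((?x * ennreal_powr ?x (b - 1)) * R i \<omega> + ?x * ennreal_powr (R i \<omega>) b)"
      unfolding mult_ennreal_powr[of ?x b, symmetric] by (simp only: distrib_left ac_simps)
    also have "?x * ennreal_powr ?x (b - 1) = ennreal_powr ?x b"
      unfolding mult_ennreal_powr by simp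
    finally show "?x * ennreal_powr (?x + (\<Sum>j. if j = i then 0 else c j * Y j \<omega>)) b
      \<le> ennreal_powr (c i) (1 + b) * ennreal_powr (Y i \<omega>) (1 + b)
        + \<kappa> * (ennreal_powr ?x b * R i \<omega> + ?x * ennreal_powr (R i \<omega>) b)"
      unfolding R_def[symmetric] by (simp add: ennreal_powr_mult)
  qed auto
  also have "\<dots> = (\<Sum>i. ennreal_powr (c i) (1 + b) * v
      + \<kappa> * ((\<integral>\<^sup>+\<omega>. ennreal_powr (c i * Y i \<omega>) b * R i \<omega> \<partial>M)
        + (\<integral>\<^sup>+\<omega>. c i * Y i \<omega> * ennreal_powr (R i \<omega>) b \<partial>M)))"
    by (simp add: nn_integral_suminf nn_integral_add nn_integral_cmult v)
  also have "\<dots> \<le> (\<Sum>i. ennreal_powr (c i) (1 + b) * v + \<kappa> * (c i * B + c i * B))"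
    by (intro suminf_le add_left_mono mult_left_mono add_mono YbR YRb allI) auto
  also have "\<dots> = (\<Sum>i. ennreal_powr (c i) (1 + b) * v + c i * (2 * \<kappa> * B))"
    by (simp only: mult_2[symmetric]) (simp only: ac_simps)
  also have "\<dots> = (\<Sum>i. ennreal_powr (c i) (1 + b)) * v + s * (2 * \<kappa> * B)"
    by (simp add: suminf_add[symmetric] s_def)
  also have "s * (2 * \<kappa> * B) = 2 * \<kappa> * (ennreal_powr s (1 + b) * (m * u))"
    by (simp only: B_def ennreal_powr_add ennreal_powr_1 ac_simps)
  also have "2 * \<kappa> = ennreal (b * 2 powr b)"
    using b by (simp add: \<kappa>_def powr_diff flip: ennreal_numeral ennreal_mult)
  finally show ?thesis by (simp only: s_def)
qed

section \<open>Unordered sums as integrals over counting measure\<close>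

lemma infsum_eq_nn_integral_count_space:
  fixes f :: "'b \<Rightarrow> ennreal"
  assumes A: "countable A"
  shows "(\<Sum>\<^sub>\<infinity>x\<in>A. f x) = (\<integral>\<^sup>+x. f x \<partial>count_space A)"
proof (cases "finite A")
  case True
  then show ?thesis by (simp add: nn_integral_count_space_finite)
next
  case False
  note bij = bij_betw_from_nat_into[OF A False]
  have SUP: "(\<Sum>\<^sub>\<infinity>x\<in>A. f x) = (SUP F\<in>{F. finite F \<and> F \<subseteq> A}. sum f F)"
    by (simp add: nonneg_infsum_complete)
  show ?thesis
  proof (rule antisym)
    show "(\<Sum>\<^sub>\<infinity>x\<in>A. f x) \<le> (\<integral>\<^sup>+x. f x \<partial>count_space A)"
      unfolding SUP
    proof (intro SUP_least)
      fix F assume F: "F \<in> {F. finite F \<and> F \<subseteq> A}"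
      then have "sum f F = (\<integral>\<^sup>+x. f x * indicator F x \<partial>count_space A)"
        by (subst nn_integral_count_space'[of F]) auto
      also have "\<dots> \<le> (\<integral>\<^sup>+x. f x \<partial>count_space A)"
        by (intro nn_integral_mono) (auto simp: indicator_def)
      finally show "sum f F \<le> (\<integral>\<^sup>+x. f x \<partial>count_space A)" .
    qed
    have "(\<integral>\<^sup>+x. f x \<partial>count_space A) = (\<Sum>n. f (from_nat_into A n))"
      by (simp add: nn_integral_bij_count_space[OF bij, symmetric] nn_integral_count_space_nat)
    also have "\<dots> \<le> (\<Sum>\<^sub>\<infinity>x\<in>A. f x)"
    proof (rule suminf_le_const)
      fix n
      have "inj_on (from_nat_into A) {..<n}"
        using bij by (auto simp: bij_betw_def intro: inj_on_subset)
      then have "(\<Sum>i<n. f (from_nat_into A i)) = sum f (from_nat_into A ` {..<n})"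
        by (simp add: sum.reindex)
      also have "\<dots> \<le> (\<Sum>\<^sub>\<infinity>x\<in>A. f x)"
        unfolding SUP using False by (intro SUP_upper) (auto intro!: from_nat_into)
      finally show "(\<Sum>i<n. f (from_nat_into A i)) \<le> (\<Sum>\<^sub>\<infinity>x\<in>A. f x)" .
    qed auto
    finally show "(\<integral>\<^sup>+x. f x \<partial>count_space A) \<le> (\<Sum>\<^sub>\<infinity>x\<in>A. f x)" .
  qed
qed

lemma nn_integral_count_space_Sigma:
  "(\<integral>\<^sup>+p. f p \<partial>count_space (Sigma A B)) = (\<integral>\<^sup>+x. \<integral>\<^sup>+y. f (x, y) \<partial>count_space (B x) \<partial>count_space A)"
proof -
  have "(\<integral>\<^sup>+p. f p \<partial>count_space (Sigma A B)) = (\<integral>\<^sup>+p. f p * indicator (Sigma A B) p \<partial>count_space UNIV)"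
    by (simp add: nn_integral_count_space_indicator)
  also have "\<dots> = (\<integral>\<^sup>+x. \<integral>\<^sup>+y. f (x, y) * indicator (Sigma A B) (x, y) \<partial>count_space UNIV \<partial>count_space UNIV)"
    by (rule nn_integral_fst_count_space[symmetric])
  also have "\<dots> = (\<integral>\<^sup>+x. (\<integral>\<^sup>+y. f (x, y) * indicator (B x) y \<partial>count_space UNIV) * indicator A x \<partial>count_space UNIV)"
    by (intro nn_integral_cong) (auto simp: indicator_def)
  finally show ?thesis
    by (simp add: nn_integral_count_space_indicator)
qed

lemma infsum_upto_enat:
  fixes f :: "nat \<Rightarrow> ennreal"
  shows "(\<Sum>\<^sub>\<infinity>i\<in>upto_enat m. f i) = (\<Sum>j. if enat (Suc j) \<le> m then f (Suc j) else 0)"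
proof -
  have "upto_enat m = Suc ` {j. enat (Suc j) \<le> m}"
    by (auto simp: upto_enat_def image_iff) (metis Suc_le_D One_nat_def)
  then have "(\<Sum>\<^sub>\<infinity>i\<in>upto_enat m. f i) = (\<integral>\<^sup>+j. f (Suc j) \<partial>count_space {j. enat (Suc j) \<le> m})"
    by (simp add: infsum_reindex o_def flip: infsum_eq_nn_integral_count_space)
  also have "\<dots> = (\<integral>\<^sup>+j. (if enat (Suc j) \<le> m then f (Suc j) else 0) \<partial>count_space UNIV)"
    by (simp add: nn_integral_count_space_indicator) (auto intro!: nn_integral_cong)
  finally show ?thesis by (simp add: nn_integral_count_space_nat)
qed

section \<open>The branching sum as a function of the node vectors\<close>

text \<open>
  The \<open>j\<close>-th child below is the child \<open>Suc j\<close> of the tree, so that sums over children are series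
  over \<^typ>\<open>nat\<close>. Children beyond \<open>N\<close> receive weight zero; this makes the number of summands
  independent of the outcome.
\<close>

definition child_weight :: "real \<times> enat \<times> (nat \<Rightarrow> real) \<Rightarrow> nat \<Rightarrow> ennreal" where
  "child_weight x j = (if enat (Suc j) \<le> fst (snd x) then ennreal (snd (snd x) (Suc j)) else 0)"

text \<open>
  The values outside the set of nodes are forgotten, which makes the result a point of the product
  space indexed by the nodes.
\<close>

definition subtree :: "nat \<Rightarrow> (nat list \<Rightarrow> 'b) \<Rightarrow> nat list \<Rightarrow> 'b" where
  "subtree j v = (\<lambda>xs\<in>nodes. v (Suc j # xs))"

text \<open>
  The decomposition of the branching sum at the root. It presents the sum as a fixed measurable
  function of the family of node vectors, so that distribution and independence of the sums over
  the subtrees can be read off from the node vectors.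
\<close>

primrec tree_sum :: "nat \<Rightarrow> (nat list \<Rightarrow> real \<times> enat \<times> (nat \<Rightarrow> real)) \<Rightarrow> ennreal" where
  "tree_sum 0 v = ennreal (fst (v []))"
| "tree_sum (Suc n) v = (\<Sum>j. child_weight (v []) j * tree_sum n (subtree j v))"

lemma Nil_in_nodes [simp]: "[] \<in> nodes"
  by (simp add: nodes_def)

lemma Cons_in_nodes_iff [simp]: "j # xs \<in> nodes \<longleftrightarrow> 1 \<le> j \<and> xs \<in> nodes"
  by (auto simp: nodes_def)

lemma snoc_in_nodes_iff [simp]: "xs @ [j] \<in> nodes \<longleftrightarrow> 1 \<le> j \<and> xs \<in> nodes"
  by (auto simp: nodes_def)

lemma generation_subset_nodes: "generation N n \<omega> \<subseteq> nodes"
  by (induction n) auto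

lemma generation_Suc_eq_Cons:
  "generation N (Suc n) \<omega> = (\<lambda>(j, ys). Suc j # ys) `
    (SIGMA j:{j. enat (Suc j) \<le> N [] \<omega>}. generation (\<lambda>xs. N (Suc j # xs)) n \<omega>)"
proof (induction n)
  case 0
  show ?case
    by (auto simp: image_iff) (metis Suc_le_D Suc_eq_plus1 add.commute plus_1_eq_Suc)
next
  case (Suc n)
  have "generation N (Suc (Suc n)) \<omega>
    = {xs @ [k] | xs k. xs \<in> generation N (Suc n) \<omega> \<and> 1 \<le> k \<and> enat k \<le> N xs \<omega>}"
    by (rule generation.simps)
  also have "\<dots> = (\<lambda>(j, ys). Suc j # ys) `
    (SIGMA j:{j. enat (Suc j) \<le> N [] \<omega>}. {ys @ [k] | ys k. ys \<in> generation (\<lambda>xs. N (Suc j # xs)) n \<omega> \<and>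
       1 \<le> k \<and> enat k \<le> N (Suc j # ys) \<omega>})"
    unfolding Suc.IH by (fastforce simp: image_iff)
  finally show ?case by simp
qed

lemma weight_Cons: "weight C (j # xs) \<omega> = C [j] \<omega> * weight (\<lambda>ys. C (j # ys)) xs \<omega>"
proof (induction xs rule: rev_induct)
  case Nil
  show ?case using weight_snoc[of C "[]" j] by simp
next
  case (snoc k xs)
  then show ?case
    using weight_snoc[of C "j # xs" k \<omega>] by simp
qed

lemma weight_nonneg:
  assumes "\<And>xs. xs \<in> nodes \<Longrightarrow> xs \<noteq> [] \<Longrightarrow> 0 \<le> C xs \<omega>" and "xs \<in> nodes"
  shows "0 \<le> weight C xs \<omega>"
  using assms(2) by (induction xs rule: rev_induct) (auto simp: assms(1))

text \<open>
  Nonnegativity is essential because \<^const>\<open>ennreal\<close> maps negative numbers to \<open>0\<close> and is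
  therefore multiplicative only on nonnegative factors.
\<close>

lemma branching_sum_Suc:
  assumes Q: "\<And>xs. xs \<in> nodes \<Longrightarrow> 0 \<le> Q xs \<omega>"
    and C: "\<And>xs. xs \<in> nodes \<Longrightarrow> xs \<noteq> [] \<Longrightarrow> 0 \<le> C xs \<omega>"
  shows "branching_sum Q N C (Suc n) \<omega> = (\<Sum>j. (if enat (Suc j) \<le> N [] \<omega> then ennreal (C [Suc j] \<omega>) else 0)
    * branching_sum (\<lambda>xs. Q (Suc j # xs)) (\<lambda>xs. N (Suc j # xs)) (\<lambda>xs. C (Suc j # xs)) n \<omega>)"
proof -
  let ?J = "{j. enat (Suc j) \<le> N [] \<omega>}"
  let ?G = "\<lambda>j. generation (\<lambda>xs. N (Suc j # xs)) n \<omega>"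
  let ?W = "\<lambda>j. branching_sum (\<lambda>xs. Q (Suc j # xs)) (\<lambda>xs. N (Suc j # xs)) (\<lambda>xs. C (Suc j # xs)) n \<omega>"
  let ?f = "\<lambda>xs. ennreal (Q xs \<omega> * weight C xs \<omega>)"
  have "branching_sum Q N C (Suc n) \<omega> = (\<Sum>\<^sub>\<infinity>xs\<in>(\<lambda>(j, ys). Suc j # ys) ` (Sigma ?J ?G). ?f xs)"
    unfolding branching_sum_def generation_Suc_eq_Cons ..
  also have "\<dots> = (\<Sum>\<^sub>\<infinity>p\<in>Sigma ?J ?G. ?f (Suc (fst p) # snd p))"
    by (subst infsum_reindex) (auto simp: inj_on_def o_def case_prod_beta)
  also have "\<dots> = (\<integral>\<^sup>+j. \<integral>\<^sup>+ys. ?f (Suc j # ys) \<partial>count_space (?G j) \<partial>count_space ?J)"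
    by (simp add: infsum_eq_nn_integral_count_space nn_integral_count_space_Sigma)
  also have "\<dots> = (\<integral>\<^sup>+j. ennreal (C [Suc j] \<omega>) * ?W j \<partial>count_space ?J)"
  proof (rule nn_integral_cong)
    fix j
    have "?f (Suc j # ys) = ennreal (C [Suc j] \<omega>)
        * ennreal (Q (Suc j # ys) \<omega> * weight (\<lambda>xs. C (Suc j # xs)) ys \<omega>)" if "ys \<in> ?G j" for ys
    proof -
      have ys: "ys \<in> nodes" by (rule subsetD[OF generation_subset_nodes that])
      then have "0 \<le> Q (Suc j # ys) \<omega> * weight (\<lambda>xs. C (Suc j # xs)) ys \<omega>"
        by (intro mult_nonneg_nonneg weight_nonneg Q C) auto
      moreover have "0 \<le> C [Suc j] \<omega>" by (intro C) auto
      ultimately show ?thesis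
        by (simp add: weight_Cons mult.left_commute flip: ennreal_mult)
    qed
    then have "(\<integral>\<^sup>+ys. ?f (Suc j # ys) \<partial>count_space (?G j)) = (\<integral>\<^sup>+ys. ennreal (C [Suc j] \<omega>)
        * ennreal (Q (Suc j # ys) \<omega> * weight (\<lambda>xs. C (Suc j # xs)) ys \<omega>) \<partial>count_space (?G j))"
      by (intro nn_integral_cong) simp
    also have "\<dots> = ennreal (C [Suc j] \<omega>) * ?W j"
      by (simp add: nn_integral_cmult branching_sum_def infsum_eq_nn_integral_count_space)
    finally show "(\<integral>\<^sup>+ys. ?f (Suc j # ys) \<partial>count_space (?G j)) = ennreal (C [Suc j] \<omega>) * ?W j" .
  qed
  also have "\<dots> = (\<Sum>j. ennreal (C [Suc j] \<omega>) * ?W j * indicator ?J j)"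
    unfolding nn_integral_count_space_nat[symmetric] by (simp add: nn_integral_count_space_indicator)
  also have "\<dots> = (\<Sum>j. (if enat (Suc j) \<le> N [] \<omega> then ennreal (C [Suc j] \<omega>) else 0) * ?W j)"
    by (intro suminf_cong) auto
  finally show ?thesis .
qed

lemma subtree_node_vec:
  "subtree j (\<lambda>xs\<in>nodes. node_vec Q N C xs \<omega>) =
    (\<lambda>xs\<in>nodes. node_vec (\<lambda>xs. Q (Suc j # xs)) (\<lambda>xs. N (Suc j # xs)) (\<lambda>xs. C (Suc j # xs)) xs \<omega>)"
  by (auto simp: subtree_def node_vec_def fun_eq_iff)

lemma child_weight_node_vec:
  "child_weight (node_vec Q N C [] \<omega>) j
    = (if enat (Suc j) \<le> N [] \<omega> then ennreal (C [Suc j] \<omega>) else 0)"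
  by (simp add: child_weight_def node_vec_def)

lemma branching_sum_eq_tree_sum:
  assumes "\<And>xs. xs \<in> nodes \<Longrightarrow> 0 \<le> Q xs \<omega>"
    and "\<And>xs. xs \<in> nodes \<Longrightarrow> xs \<noteq> [] \<Longrightarrow> 0 \<le> C xs \<omega>"
  shows "branching_sum Q N C n \<omega> = tree_sum n (\<lambda>xs\<in>nodes. node_vec Q N C xs \<omega>)"
  using assms
proof (induction n arbitrary: Q N C)
  case 0
  then show ?case by (simp add: branching_sum_0 node_vec_def)
next
  case (Suc n)
  have "branching_sum (\<lambda>xs. Q (Suc j # xs)) (\<lambda>xs. N (Suc j # xs)) (\<lambda>xs. C (Suc j # xs)) n \<omega>
    = tree_sum n (subtree j (\<lambda>xs\<in>nodes. node_vec Q N C xs \<omega>))" for j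
    unfolding subtree_node_vec by (rule Suc.IH) (auto intro: Suc.prems)
  then show ?case
    by (subst branching_sum_Suc) (simp_all add: Suc.prems child_weight_node_vec cong: if_cong)
qed

lemma measurable_child_weight [measurable]:
  "(\<lambda>x. child_weight x j) \<in> borel_measurable vec_measure"
proof -
  have [measurable]: "(\<lambda>f. f (Suc j)) \<in> borel_measurable (\<Pi>\<^sub>M j\<in>{1..}. borel :: real measure)"
    by (rule measurable_component_singleton) simp
  show ?thesis
    unfolding child_weight_def vec_measure_def by measurable
qed

lemma measurable_subtree:
  assumes "Cons (Suc j) ` nodes \<subseteq> A"
  shows "subtree j \<in> measurable (PiM A (\<lambda>_. K)) (PiM nodes (\<lambda>_. K))"
  unfolding subtree_def using assms
  by (intro measurable_restrict measurable_component_singleton) auto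

lemma measurable_tree_sum [measurable]:
  "tree_sum n \<in> borel_measurable (PiM nodes (\<lambda>_. vec_measure))"
proof (induction n)
  case 0
  have [measurable]: "fst \<in> borel_measurable vec_measure"
    unfolding vec_measure_def by measurable
  show ?case by simp
next
  case (Suc n)
  note [measurable] = Suc measurable_subtree
  have "(\<lambda>v. tree_sum n (subtree j v)) \<in> borel_measurable (PiM nodes (\<lambda>_. vec_measure))" for j
    by (rule measurable_compose[OF measurable_subtree Suc]) auto
  then show ?case by simp
qed

lemma subtree_restrict:
  assumes "Cons (Suc j) ` nodes \<subseteq> A"
  shows "subtree j (restrict v A) = subtree j v"
  using assms by (auto simp: subtree_def fun_eq_iff)

section \<open>Independence and conditioning\<close>

text \<open>
  Conditioning on \<open>X\<close> by Fubini's theorem. Both integrals on the right run over the original space,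
  so the inner one, with \<open>X \<omega>\<close> held fixed, is again an expectation of a function of \<open>Z\<close>.
\<close>

lemma (in prob_space) nn_integral_indep_pair:
  assumes indep: "indep_var S X T Z" and F [measurable]: "F \<in> borel_measurable (S \<Otimes>\<^sub>M T)"
  shows "(\<integral>\<^sup>+\<omega>. F (X \<omega>, Z \<omega>) \<partial>M) = (\<integral>\<^sup>+\<omega>. \<integral>\<^sup>+\<omega>'. F (X \<omega>, Z \<omega>') \<partial>M \<partial>M)"
proof -
  have [measurable]: "X \<in> measurable M S" "Z \<in> measurable M T"
    and eq: "distr M S X \<Otimes>\<^sub>M distr M T Z = distr M (S \<Otimes>\<^sub>M T) (\<lambda>\<omega>. (X \<omega>, Z \<omega>))"
    using indep by (auto simp: indep_var_distribution_eq)
  interpret Z: prob_space "distr M T Z" by (rule prob_space_distr) simp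
  have "(\<integral>\<^sup>+\<omega>. F (X \<omega>, Z \<omega>) \<partial>M) = (\<integral>\<^sup>+p. F p \<partial>(distr M S X \<Otimes>\<^sub>M distr M T Z))"
    unfolding eq by (subst nn_integral_distr) simp_all
  also have "\<dots> = (\<integral>\<^sup>+x. \<integral>\<^sup>+z. F (x, z) \<partial>distr M T Z \<partial>distr M S X)"
    by (subst Z.nn_integral_fst) simp_all
  also have "\<dots> = (\<integral>\<^sup>+\<omega>. \<integral>\<^sup>+\<omega>'. F (X \<omega>, Z \<omega>') \<partial>M \<partial>M)"
    by (subst nn_integral_distr, simp, measurable)
      (intro nn_integral_cong, subst nn_integral_distr, auto intro!: measurable_compose[OF _ F])
  finally show ?thesis .
qed

section \<open>Moment recursion and geometric decay\<close>

text \<open>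
  The inhomogeneous term is smaller than the rate \<open>r\<^sup>n\<close> by a factor \<open>q\<^sup>n\<close>. After division by \<open>r\<^sup>n\<close> the
  increments are therefore summable, and no worse rate than \<open>r\<close> results.
\<close>

lemma geometric_recursion_bound:
  fixes A :: "nat \<Rightarrow> ennreal" and r q D :: real
  assumes r: "0 < r" and q: "0 \<le> q" "q < 1" and D: "0 \<le> D" and A0: "A 0 < \<top>"
    and step: "\<And>n. A (Suc n) \<le> ennreal r * A n + ennreal (D * (r ^ n * q ^ n))"
  shows "\<exists>K\<ge>0. \<forall>n. A n \<le> ennreal (K * r ^ n)"
proof -
  obtain A\<^sub>0 where A\<^sub>0: "A 0 = ennreal A\<^sub>0" "0 \<le> A\<^sub>0"
    using A0 by (cases "A 0") auto
  define k where "k n = A\<^sub>0 + D / r * (\<Sum>i<n. q ^ i)" for n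
  have k_nonneg: "0 \<le> k n" for n
    unfolding k_def using A\<^sub>0 r q D by (intro add_nonneg_nonneg mult_nonneg_nonneg sum_nonneg) auto
  have A_le: "A n \<le> ennreal (k n * r ^ n)" for n
  proof (induction n)
    case 0
    then show ?case by (simp add: k_def A\<^sub>0)
  next
    case (Suc n)
    have "A (Suc n) \<le> ennreal r * ennreal (k n * r ^ n) + ennreal (D * (r ^ n * q ^ n))"
      using step[of n] Suc by (meson add_right_mono mult_left_mono order_trans zero_le)
    also have "\<dots> = ennreal (r * (k n * r ^ n) + D * (r ^ n * q ^ n))"
      using r q D k_nonneg[of n] by (simp add: ennreal_mult)
    also have "r * (k n * r ^ n) + D * (r ^ n * q ^ n) = k (Suc n) * r ^ Suc n"
      using r by (simp add: k_def field_simps)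
    finally show ?case .
  qed
  define K where "K = A\<^sub>0 + D / r * (1 / (1 - q))"
  have "k n \<le> K" for n
  proof -
    have "(\<Sum>i<n. q ^ i) \<le> (\<Sum>i. q ^ i)"
      using q by (intro sum_le_suminf summable_geometric) auto
    also have "\<dots> = 1 / (1 - q)"
      using q by (simp add: suminf_geometric)
    finally show ?thesis
      unfolding k_def K_def using D r by (intro add_left_mono mult_left_mono) auto
  qed
  then have "A n \<le> ennreal (K * r ^ n)" for n
    using r by (intro order_trans[OF A_le] ennreal_leI mult_right_mono) auto
  moreover have "0 \<le> K"
    unfolding K_def using A\<^sub>0 r q D by simp
  ultimately show ?thesis by blast
qed

context weighted_branching
begin

definition family :: "'a \<Rightarrow> nat list \<Rightarrow> real \<times> enat \<times> (nat \<Rightarrow> real)" where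
  "family \<omega> = (\<lambda>xs\<in>nodes. node_vec Q N C xs \<omega>)"

definition root_weight :: "nat \<Rightarrow> 'a \<Rightarrow> ennreal" where
  "root_weight j \<omega> = child_weight (node_vec Q N C [] \<omega>) j"

definition moment :: "nat \<Rightarrow> real \<Rightarrow> ennreal" where
  "moment n \<gamma> = (\<integral>\<^sup>+\<omega>. ennreal_powr (tree_sum n (family \<omega>)) \<gamma> \<partial>M)"

lemma measurable_node_vec: "xs \<in> nodes \<Longrightarrow> node_vec Q N C xs \<in> measurable M vec_measure"
  using indep by (simp add: indep_vars_def)

lemma measurable_family [measurable]: "family \<in> measurable M (PiM nodes (\<lambda>_. vec_measure))"
  unfolding family_def by (intro measurable_restrict measurable_node_vec)

lemma subtree_family: "subtree j (family \<omega>) = subtree j (\<lambda>xs. node_vec Q N C xs \<omega>)"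
  by (auto simp: subtree_def family_def fun_eq_iff)

lemma measurable_root_weight [measurable]: "root_weight j \<in> borel_measurable M"
  unfolding root_weight_def
  by (rule measurable_compose[OF measurable_node_vec measurable_child_weight]) simp

text \<open>
  Almost sure properties of the root vector carry over to every node, as they depend only on the
  distribution.
\<close>

lemma AE_node_vec:
  assumes "xs \<in> nodes" and [measurable]: "Measurable.pred vec_measure P"
    and "AE \<omega> in M. P (node_vec Q N C [] \<omega>)"
  shows "AE \<omega> in M. P (node_vec Q N C xs \<omega>)"
proof -
  have "(AE x in distr M vec_measure (node_vec Q N C ys). P x) \<longleftrightarrow> (AE \<omega> in M. P (node_vec Q N C ys \<omega>))"
    if "ys \<in> nodes" for ys
    using that by (intro AE_distr_iff measurable_node_vec) measurable
  from this[OF assms(1)] this[OF Nil_in_nodes] show ?thesis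
    using assms(3) unfolding ident[OF assms(1)] by blast
qed

text \<open>
  The weight of a node other than the root is a component of the vector of its parent, whose
  distribution is that of the vector at the root; there are only countably many nodes.
\<close>

lemma AE_nonneg:
  "AE \<omega> in M. (\<forall>xs\<in>nodes. 0 \<le> Q xs \<omega>) \<and> (\<forall>xs\<in>nodes. xs \<noteq> [] \<longrightarrow> 0 \<le> C xs \<omega>)"
proof -
  have "AE \<omega> in M. 0 \<le> Q xs \<omega>" if "xs \<in> nodes" for xs
  proof -
    have "Measurable.pred vec_measure (\<lambda>x. 0 \<le> fst x)"
      unfolding vec_measure_def by measurable
    from AE_node_vec[OF that this] show ?thesis
      using nonneg_Q by (simp add: node_vec_def)
  qed
  moreover have "AE \<omega> in M. xs \<noteq> [] \<longrightarrow> 0 \<le> C xs \<omega>" if xs: "xs \<in> nodes" for xs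
  proof (cases xs rule: rev_cases)
    case (snoc ys j)
    then have j: "1 \<le> j" and ys: "ys \<in> nodes" using xs by auto
    have [measurable]: "(\<lambda>f. f j) \<in> borel_measurable (\<Pi>\<^sub>M j\<in>{1..}. borel :: real measure)"
      using j by (intro measurable_component_singleton) simp
    have "Measurable.pred vec_measure (\<lambda>x. 0 \<le> snd (snd x) j)"
      unfolding vec_measure_def by measurable
    from AE_node_vec[OF ys this] show ?thesis
      using nonneg_C[OF j] j snoc by (simp add: node_vec_def)
  qed simp
  ultimately show ?thesis
    by (simp add: AE_conj_iff AE_ball_countable)
qed

lemma AE_branching_sum_eq: "AE \<omega> in M. branching_sum Q N C n \<omega> = tree_sum n (family \<omega>)"
  using AE_nonneg by eventually_elim (simp add: family_def branching_sum_eq_tree_sum)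

lemma nn_integral_branching_sum_powr:
  "(\<integral>\<^sup>+\<omega>. ennreal_powr (branching_sum Q N C n \<omega>) \<gamma> \<partial>M) = moment n \<gamma>"
  unfolding moment_def
proof (rule nn_integral_cong_AE)
  show "AE \<omega> in M. ennreal_powr (branching_sum Q N C n \<omega>) \<gamma> = ennreal_powr (tree_sum n (family \<omega>)) \<gamma>"
    using AE_branching_sum_eq[of n] by eventually_elim simp
qed

lemma moment_0: "moment 0 \<gamma> = (\<integral>\<^sup>+\<omega>. ennreal (Q [] \<omega> powr \<gamma>) \<partial>M)"
  unfolding moment_def
proof (rule nn_integral_cong_AE)
  show "AE \<omega> in M. ennreal_powr (tree_sum 0 (family \<omega>)) \<gamma> = ennreal (Q [] \<omega> powr \<gamma>)"
    using nonneg_Q by eventually_elim (simp add: family_def node_vec_def)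
qed

lemma rho_eq: "rho M N C \<gamma> = (\<integral>\<^sup>+\<omega>. (\<Sum>j. ennreal_powr (root_weight j \<omega>) \<gamma>) \<partial>M)"
  unfolding rho_def infsum_upto_enat
proof (rule nn_integral_cong_AE)
  show "AE \<omega> in M. (\<Sum>j. if enat (Suc j) \<le> N [] \<omega> then ennreal (C [Suc j] \<omega> powr \<gamma>) else 0)
    = (\<Sum>j. ennreal_powr (root_weight j \<omega>) \<gamma>)"
    using AE_nonneg by eventually_elim (auto intro!: suminf_cong simp: root_weight_def child_weight_node_vec)
qed

lemma infsum_children_eq: "(\<Sum>\<^sub>\<infinity>i\<in>upto_enat (N [] \<omega>). ennreal (C [i] \<omega>)) = (\<Sum>j. root_weight j \<omega>)"
  by (simp add: infsum_upto_enat root_weight_def child_weight_node_vec)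

lemma distr_family:
  "distr M (PiM nodes (\<lambda>_. vec_measure)) family = PiM nodes (\<lambda>_. distr M vec_measure (node_vec Q N C []))"
proof -
  have "distr M (PiM nodes (\<lambda>_. vec_measure)) family = PiM nodes (\<lambda>xs. distr M vec_measure (node_vec Q N C xs))"
    unfolding family_def[abs_def]
    using indep indep_vars_iff_distr_eq_PiM'[of nodes "node_vec Q N C" "\<lambda>_. vec_measure"]
    by (auto simp: measurable_node_vec) (use Nil_in_nodes in blast)
  also have "\<dots> = PiM nodes (\<lambda>_. distr M vec_measure (node_vec Q N C []))"
    by (intro PiM_cong ident) auto
  finally show ?thesis .
qed

text \<open>
  The law of the whole family is a product measure with identical factors, and an injective
  relabelling of the coordinates preserves such a measure.
\<close>

lemma distr_subtree:
  "distr M (PiM nodes (\<lambda>_. vec_measure)) (\<lambda>\<omega>. subtree j (family \<omega>)) = distr M (PiM nodes (\<lambda>_. vec_measure)) family"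
proof -
  let ?\<mu> = "distr M vec_measure (node_vec Q N C [])"
  have [measurable]: "subtree j \<in> measurable (PiM nodes (\<lambda>_. vec_measure)) (PiM nodes (\<lambda>_. vec_measure))"
    by (rule measurable_subtree) auto
  have "distr M (PiM nodes (\<lambda>_. vec_measure)) (\<lambda>\<omega>. subtree j (family \<omega>))
    = distr (distr M (PiM nodes (\<lambda>_. vec_measure)) family) (PiM nodes (\<lambda>_. vec_measure)) (subtree j)"
    by (subst distr_distr) (auto simp: o_def)
  also have "\<dots> = distr (PiM nodes (\<lambda>_. ?\<mu>)) (PiM nodes (\<lambda>_. ?\<mu>)) (\<lambda>v. \<lambda>xs\<in>nodes. v (Suc j # xs))"
    unfolding distr_family by (intro distr_cong) (auto simp: subtree_def intro!: sets_PiM_cong)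
  also have "\<dots> = PiM nodes (\<lambda>_. ?\<mu>)"
    by (rule distr_PiM_reindex) (auto intro!: prob_space_distr measurable_node_vec)
  finally show ?thesis by (simp add: distr_family)
qed

lemma nn_integral_tree_sum_subtree:
  assumes [measurable]: "g \<in> borel_measurable borel"
  shows "(\<integral>\<^sup>+\<omega>. g (tree_sum n (subtree j (family \<omega>))) \<partial>M) = (\<integral>\<^sup>+\<omega>. g (tree_sum n (family \<omega>)) \<partial>M)"
proof -
  let ?P = "PiM nodes (\<lambda>_. vec_measure)"
  have [measurable]: "subtree j \<in> measurable ?P ?P"
    by (rule measurable_subtree) auto
  have "(\<integral>\<^sup>+\<omega>. g (tree_sum n (subtree j (family \<omega>))) \<partial>M)
    = (\<integral>\<^sup>+v. g (tree_sum n v) \<partial>distr M ?P (\<lambda>\<omega>. subtree j (family \<omega>)))"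
    by (subst nn_integral_distr) auto
  also have "\<dots> = (\<integral>\<^sup>+\<omega>. g (tree_sum n (family \<omega>)) \<partial>M)"
    unfolding distr_subtree by (subst nn_integral_distr) auto
  finally show ?thesis .
qed

text \<open>
  The subtrees at different children have disjoint sets of nodes.
\<close>

lemma indep_tree_sum_subtrees:
  assumes "i \<noteq> j"
  shows "indep_var borel (\<lambda>\<omega>. tree_sum n (subtree i (family \<omega>))) borel (\<lambda>\<omega>. tree_sum n (subtree j (family \<omega>)))"
proof -
  let ?A = "\<lambda>i. Cons (Suc i) ` nodes"
  have sub: "?A i \<subseteq> nodes" for i by auto
  have meas: "(\<lambda>v. tree_sum n (subtree i v)) \<in> borel_measurable (PiM (?A i) (\<lambda>_. vec_measure))" for i
    by (rule measurable_compose[OF measurable_subtree measurable_tree_sum]) simp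
  have "indep_var (PiM (?A i) (\<lambda>_. vec_measure)) (\<lambda>\<omega>. restrict (\<lambda>xs. node_vec Q N C xs \<omega>) (?A i))
      (PiM (?A j) (\<lambda>_. vec_measure)) (\<lambda>\<omega>. restrict (\<lambda>xs. node_vec Q N C xs \<omega>) (?A j))"
    using assms by (intro indep_var_restrict[OF indep] sub) auto
  from indep_var_compose[OF this meas meas] show ?thesis
    by (simp add: o_def subtree_family subtree_restrict)
qed

text \<open>
  The root vector is independent of all other node vectors, and the weights at the first generation
  depend on the root vector only. Hence a moment bound for weighted sums with constant weights \<open>c\<close>
  may be integrated over the random weights.
\<close>

lemma moment_Suc_le:
  assumes G: "\<And>c. (\<integral>\<^sup>+\<omega>. ennreal_powr (\<Sum>j. c j * tree_sum n (subtree j (family \<omega>))) \<gamma> \<partial>M) \<le> G c"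
  shows "moment (Suc n) \<gamma> \<le> (\<integral>\<^sup>+\<omega>. G (\<lambda>j. root_weight j \<omega>) \<partial>M)"
proof -
  define B where "B = nodes - {[]}"
  define X where "X \<omega> = restrict (\<lambda>xs. node_vec Q N C xs \<omega>) {[]}" for \<omega>
  define Z where "Z \<omega> = restrict (\<lambda>xs. node_vec Q N C xs \<omega>) B" for \<omega>
  define F where "F = (\<lambda>(x :: nat list \<Rightarrow> real \<times> enat \<times> (nat \<Rightarrow> real), z). ennreal_powr (\<Sum>j. child_weight (x []) j * tree_sum n (subtree j z)) \<gamma>)"
  have sub: "Cons (Suc j) ` nodes \<subseteq> B" for j by (auto simp: B_def)
  have ind: "indep_var (PiM {[]} (\<lambda>_. vec_measure)) X (PiM B (\<lambda>_. vec_measure)) Z"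
    unfolding X_def[abs_def] Z_def[abs_def] by (intro indep_var_restrict[OF indep]) (auto simp: B_def)
  have [measurable]: "(\<lambda>z. tree_sum n (subtree j z)) \<in> borel_measurable (PiM B (\<lambda>_. vec_measure))" for j
    by (rule measurable_compose[OF measurable_subtree measurable_tree_sum]) (rule sub)
  have [measurable]: "(\<lambda>x. child_weight (x []) j) \<in> borel_measurable (PiM {[]} (\<lambda>_. vec_measure))" for j
    by (rule measurable_compose[OF _ measurable_child_weight], rule measurable_component_singleton) simp
  have F: "F \<in> borel_measurable (PiM {[]} (\<lambda>_. vec_measure) \<Otimes>\<^sub>M PiM B (\<lambda>_. vec_measure))"
    unfolding F_def by measurable
  have subtree_Z: "subtree j (Z \<omega>) = subtree j (family \<omega>)" for j \<omega>
    unfolding Z_def subtree_family subtree_restrict[OF sub] ..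
  have X_root: "child_weight (X \<omega> []) j = root_weight j \<omega>" for j \<omega>
    by (simp add: X_def root_weight_def)
  have "moment (Suc n) \<gamma> = (\<integral>\<^sup>+\<omega>. F (X \<omega>, Z \<omega>) \<partial>M)"
    by (simp add: moment_def F_def X_root subtree_Z) (simp add: family_def root_weight_def)
  also have "\<dots> = (\<integral>\<^sup>+\<omega>. \<integral>\<^sup>+\<omega>'. F (X \<omega>, Z \<omega>') \<partial>M \<partial>M)"
    by (rule nn_integral_indep_pair[OF ind F])
  also have "\<dots> \<le> (\<integral>\<^sup>+\<omega>. G (\<lambda>j. root_weight j \<omega>) \<partial>M)"
    by (intro nn_integral_mono) (simp add: F_def X_root subtree_Z G)
  finally show ?thesis .
qed

lemma measurable_tree_sum_subtree [measurable]:
  "(\<lambda>\<omega>. tree_sum n (subtree j (family \<omega>))) \<in> borel_measurable M"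
  by (rule measurable_compose[OF measurable_compose[OF measurable_family measurable_subtree] measurable_tree_sum]) auto

lemma moment_Suc_1: "moment (Suc n) 1 \<le> rho M N C 1 * moment n 1"
proof -
  have "(\<integral>\<^sup>+\<omega>. ennreal_powr (\<Sum>j. c j * tree_sum n (subtree j (family \<omega>))) 1 \<partial>M) \<le> (\<Sum>j. c j) * moment n 1" for c
    using nn_integral_tree_sum_subtree[of "\<lambda>x. x" n]
    by (simp add: nn_integral_suminf nn_integral_cmult moment_def)
  from moment_Suc_le[OF this] show ?thesis
    by (simp add: rho_eq nn_integral_multc)
qed

lemma moment_Suc_concave:
  assumes b: "0 < b" "b \<le> 1"
  shows "moment (Suc n) (1 + b) \<le> rho M N C (1 + b) * moment n (1 + b)
    + (\<integral>\<^sup>+\<omega>. ennreal_powr (\<Sum>j. root_weight j \<omega>) (1 + b) \<partial>M) * (moment n 1 * ennreal_powr (moment n 1) b)"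
proof -
  have "(\<integral>\<^sup>+\<omega>. tree_sum n (subtree j (family \<omega>)) \<partial>M) = moment n 1" for j
    using nn_integral_tree_sum_subtree[of "\<lambda>x. x" n] by (simp add: moment_def)
  moreover have "(\<integral>\<^sup>+\<omega>. ennreal_powr (tree_sum n (subtree j (family \<omega>))) (1 + b) \<partial>M) = moment n (1 + b)" for j
    unfolding moment_def by (rule nn_integral_tree_sum_subtree) measurable
  ultimately have "(\<integral>\<^sup>+\<omega>. ennreal_powr (\<Sum>j. c j * tree_sum n (subtree j (family \<omega>))) (1 + b) \<partial>M)
    \<le> (\<Sum>i. ennreal_powr (c i) (1 + b)) * moment n (1 + b)
      + ennreal_powr (\<Sum>i. c i) (1 + b) * (moment n 1 * ennreal_powr (moment n 1) b)" for c
    by (intro nn_integral_weighted_sum_powr_le_concave indep_tree_sum_subtrees measurable_tree_sum_subtree b)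
  from moment_Suc_le[OF this] show ?thesis
    by (simp add: rho_eq nn_integral_multc nn_integral_add)
qed

lemma moment_Suc_convex:
  assumes b: "1 < b"
  shows "moment (Suc n) (1 + b) \<le> rho M N C (1 + b) * moment n (1 + b)
    + ennreal (b * 2 powr b) *
      ((\<integral>\<^sup>+\<omega>. ennreal_powr (\<Sum>j. root_weight j \<omega>) (1 + b) \<partial>M) * (moment n 1 * moment n b))"
proof -
  have "(\<integral>\<^sup>+\<omega>. tree_sum n (subtree j (family \<omega>)) \<partial>M) = moment n 1" for j
    using nn_integral_tree_sum_subtree[of "\<lambda>x. x" n] by (simp add: moment_def)
  moreover have "(\<integral>\<^sup>+\<omega>. ennreal_powr (tree_sum n (subtree j (family \<omega>))) \<gamma> \<partial>M) = moment n \<gamma>" for j \<gamma>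
    unfolding moment_def by (rule nn_integral_tree_sum_subtree) measurable
  ultimately have "(\<integral>\<^sup>+\<omega>. ennreal_powr (\<Sum>j. c j * tree_sum n (subtree j (family \<omega>))) (1 + b) \<partial>M)
    \<le> (\<Sum>i. ennreal_powr (c i) (1 + b)) * moment n (1 + b)
      + ennreal (b * 2 powr b) * (ennreal_powr (\<Sum>i. c i) (1 + b) * (moment n 1 * moment n b))" for c
    by (intro nn_integral_weighted_sum_powr_le_convex indep_tree_sum_subtrees measurable_tree_sum_subtree b)
  from moment_Suc_le[OF this] show ?thesis
    by (simp add: rho_eq nn_integral_multc nn_integral_cmult nn_integral_add)
qed

lemma nn_integral_powr_finite_mono:
  assumes [measurable]: "f \<in> borel_measurable M" and "0 \<le> a" "a \<le> b"
    and fin: "(\<integral>\<^sup>+\<omega>. ennreal_powr (f \<omega>) b \<partial>M) < \<top>"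
  shows "(\<integral>\<^sup>+\<omega>. ennreal_powr (f \<omega>) a \<partial>M) < \<top>"
proof -
  have "(\<integral>\<^sup>+\<omega>. ennreal_powr (f \<omega>) a \<partial>M) \<le> (\<integral>\<^sup>+\<omega>. 1 + ennreal_powr (f \<omega>) b \<partial>M)"
    using assms by (intro nn_integral_mono ennreal_powr_le_1_plus)
  also have "\<dots> = 1 + (\<integral>\<^sup>+\<omega>. ennreal_powr (f \<omega>) b \<partial>M)"
    by (simp add: nn_integral_add emeasure_space_1)
  also have "\<dots> < \<top>" using fin by simp
  finally show ?thesis .
qed

text \<open>
  The exponent \<open>\<gamma>\<close> is a convex combination of \<open>1\<close> and \<open>\<beta>\<close>, and the pointwise interpolation bound is
  linear in the powers with these two exponents.
\<close>

lemma rho_le_max: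
  assumes "1 < \<beta>" "1 \<le> \<gamma>" "\<gamma> \<le> \<beta>"
  shows "rho M N C \<gamma> \<le> max (rho M N C 1) (rho M N C \<beta>)"
proof -
  define a where "a = (\<gamma> - 1) / (\<beta> - 1)"
  have a: "0 \<le> a" "a \<le> 1" and \<gamma>: "\<gamma> = 1 + a * (\<beta> - 1)"
    using assms by (auto simp: a_def field_simps)
  have "rho M N C \<gamma> \<le> (\<integral>\<^sup>+\<omega>. (\<Sum>j. ennreal (1 - a) * root_weight j \<omega>
      + ennreal a * ennreal_powr (root_weight j \<omega>) \<beta>) \<partial>M)"
    unfolding rho_eq \<gamma>
    using ennreal_powr_le_interpolate[OF a, of _ "\<beta> - 1"] by (intro nn_integral_mono suminf_le) auto
  also have "\<dots> = ennreal (1 - a) * rho M N C 1 + ennreal a * rho M N C \<beta>"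
    by (simp add: rho_eq suminf_add[symmetric] nn_integral_add nn_integral_cmult)
  also have "\<dots> \<le> ennreal (1 - a) * max (rho M N C 1) (rho M N C \<beta>) + ennreal a * max (rho M N C 1) (rho M N C \<beta>)"
    by (intro add_mono mult_left_mono) auto
  also have "\<dots> = max (rho M N C 1) (rho M N C \<beta>)"
    using a by (simp flip: distrib_right ennreal_plus)
  finally show ?thesis .
qed

text \<open>
  Induction on the integer part of the exponent. The recursion for the exponent \<open>1 + b\<close> involves the
  moment of order \<open>1\<close> and, if \<open>b > 1\<close>, the moment of order \<open>b\<close>, all of which decay like \<open>r\<^sup>n\<close> already.
  Their product decays like \<open>r\<^sup>n q\<^sup>n\<close> with \<open>q = r\<^sup>b\<close> or \<open>q = r\<close>. All exponents use the same rate
  \<open>r\<close>, which is possible because \<open>\<rho>\<close> at an intermediate exponent does not exceed its maximum at the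
  end points.
\<close>

lemma moment_geometric_decay:
  assumes \<beta>: "1 < \<beta>" and Q: "moment 0 \<beta> < \<top>"
    and C: "(\<integral>\<^sup>+\<omega>. ennreal_powr (\<Sum>j. root_weight j \<omega>) \<beta> \<partial>M) < \<top>"
    and r: "max (rho M N C 1) (rho M N C \<beta>) = ennreal r" "0 < r" "r < 1"
    and \<gamma>: "1 \<le> \<gamma>" "\<gamma> \<le> \<beta>"
  shows "\<exists>K\<ge>0. \<forall>n. moment n \<gamma> \<le> ennreal (K * r ^ n)"
proof -
  have [measurable]: "(\<lambda>\<omega>. tree_sum 0 (family \<omega>)) \<in> borel_measurable M"
    by (rule measurable_compose[OF measurable_family measurable_tree_sum])
  have Q_fin: "moment 0 \<gamma> < \<top>" if "1 \<le> \<gamma>" "\<gamma> \<le> \<beta>" for \<gamma>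
    unfolding moment_def
    by (rule nn_integral_powr_finite_mono[OF _ _ _ Q[unfolded moment_def]]) (use that in \<open>auto simp del: tree_sum.simps\<close>)
  have C_fin: "(\<integral>\<^sup>+\<omega>. ennreal_powr (\<Sum>j. root_weight j \<omega>) \<gamma> \<partial>M) < \<top>" if "1 \<le> \<gamma>" "\<gamma> \<le> \<beta>" for \<gamma>
    by (rule nn_integral_powr_finite_mono[OF _ _ _ C]) (use that in auto)
  have rho_le: "rho M N C \<gamma> \<le> ennreal r" if "1 \<le> \<gamma>" "\<gamma> \<le> \<beta>" for \<gamma>
    using rho_le_max[OF \<beta> that] by (simp add: r)
  obtain K\<^sub>1 where K\<^sub>1: "0 \<le> K\<^sub>1" and m1: "moment n 1 \<le> ennreal (K\<^sub>1 * r ^ n)" for n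
  proof -
    have "\<exists>K\<ge>0. \<forall>n. moment n 1 \<le> ennreal (K * r ^ n)"
    proof (rule geometric_recursion_bound[where q = 0 and D = 0])
      fix n
      show "moment (Suc n) 1 \<le> ennreal r * moment n 1 + ennreal (0 * (r ^ n * 0 ^ n))"
        using order_trans[OF moment_Suc_1 mult_right_mono[OF rho_le[of 1]]] \<beta> by simp
    qed (use r Q_fin \<beta> in auto)
    then show ?thesis using that by blast
  qed
  have "\<exists>K\<ge>0. \<forall>n. moment n \<gamma> \<le> ennreal (K * r ^ n)" if "1 \<le> \<gamma>" "\<gamma> \<le> \<beta>" "\<gamma> \<le> real k + 1" for k \<gamma>
    using that
  proof (induction k arbitrary: \<gamma>)
    case 0
    then show ?case using K\<^sub>1 m1 by auto
  next
    case (Suc k)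
    define b where "b = \<gamma> - 1"
    obtain c where c: "(\<integral>\<^sup>+\<omega>. ennreal_powr (\<Sum>j. root_weight j \<omega>) \<gamma> \<partial>M) = ennreal c" "0 \<le> c"
      using C_fin[OF Suc.prems(1,2)] by (cases "\<integral>\<^sup>+\<omega>. ennreal_powr (\<Sum>j. root_weight j \<omega>) \<gamma> \<partial>M") auto
    have \<gamma>_eq: "\<gamma> = 1 + b" by (simp add: b_def)
    have rho_mult: "rho M N C \<gamma> * moment n \<gamma> \<le> ennreal r * moment n \<gamma>" for n
      using rho_le[OF Suc.prems(1,2)] by (rule mult_right_mono) simp
    consider "\<gamma> = 1" | "0 < b" "b \<le> 1" | "1 < b" using Suc.prems(1) unfolding b_def by linarith
    then show ?case
    proof cases
      case 1
      then show ?thesis using K\<^sub>1 m1 by auto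
    next
      case 2
      show ?thesis
      proof (rule geometric_recursion_bound[where q = "r powr b" and D = "c * (K\<^sub>1 * K\<^sub>1 powr b)"])
        show "r powr b < 1" using r 2 powr_less_mono2[of b r 1] by simp
        fix n
        have "moment (Suc n) \<gamma> \<le> rho M N C \<gamma> * moment n \<gamma> + ennreal c * (moment n 1 * ennreal_powr (moment n 1) b)"
          using moment_Suc_concave[OF 2, of n] by (simp only: \<gamma>_eq[symmetric] c)
        also have "\<dots> \<le> ennreal r * moment n \<gamma> + ennreal c * (ennreal (K\<^sub>1 * r ^ n) * ennreal_powr (ennreal (K\<^sub>1 * r ^ n)) b)"
          using 2 by (intro add_mono rho_mult mult_left_mono mult_mono ennreal_powr_mono m1) auto
        also have "ennreal c * (ennreal (K\<^sub>1 * r ^ n) * ennreal_powr (ennreal (K\<^sub>1 * r ^ n)) b)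
          = ennreal (c * (K\<^sub>1 * K\<^sub>1 powr b) * (r ^ n * (r powr b) ^ n))"
          using c K\<^sub>1 r by (simp add: powr_mult ennreal_mult[symmetric] powr_powr powr_realpow[symmetric] ac_simps)
        finally show "moment (Suc n) \<gamma> \<le> ennreal r * moment n \<gamma>
          + ennreal (c * (K\<^sub>1 * K\<^sub>1 powr b) * (r ^ n * (r powr b) ^ n))" .
      qed (use r c K\<^sub>1 Q_fin Suc.prems in auto)
    next
      case 3
      have "b \<le> \<beta>" "b \<le> real k + 1" using Suc.prems by (auto simp: b_def)
      then obtain K where K: "0 \<le> K" and mb: "\<And>n. moment n b \<le> ennreal (K * r ^ n)"
        using Suc.IH[of b] 3 by auto
      show ?thesis
      proof (rule geometric_recursion_bound[where q = r and D = "b * 2 powr b * (c * (K\<^sub>1 * K))"])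
        fix n
        have "moment (Suc n) \<gamma> \<le> rho M N C \<gamma> * moment n \<gamma>
            + ennreal (b * 2 powr b) * (ennreal c * (moment n 1 * moment n b))"
          using moment_Suc_convex[OF 3, of n] by (simp only: \<gamma>_eq[symmetric] c)
        also have "\<dots> \<le> ennreal r * moment n \<gamma>
            + ennreal (b * 2 powr b) * (ennreal c * (ennreal (K\<^sub>1 * r ^ n) * ennreal (K * r ^ n)))"
          by (intro add_mono rho_mult mult_left_mono mult_mono m1 mb) auto
        also have "ennreal (b * 2 powr b) * (ennreal c * (ennreal (K\<^sub>1 * r ^ n) * ennreal (K * r ^ n)))
          = ennreal (b * 2 powr b * (c * (K\<^sub>1 * K)) * (r ^ n * r ^ n))"
          using c K\<^sub>1 K r 3 by (simp add: ennreal_mult[symmetric] ac_simps)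
        finally show "moment (Suc n) \<gamma> \<le> ennreal r * moment n \<gamma>
          + ennreal (b * 2 powr b * (c * (K\<^sub>1 * K)) * (r ^ n * r ^ n))" .
      qed (use r c K\<^sub>1 K 3 Q_fin Suc.prems in auto)
    qed
  qed
  from this[of \<gamma> "nat \<lceil>\<gamma>\<rceil>"] \<gamma> show ?thesis by (simp add: real_nat_ceiling_ge add_increasing2)
qed

text \<open>
  The degenerate case of rate \<open>0\<close>, where one cannot divide by powers of the rate: the first moment
  vanishes from generation \<open>1\<close> on, hence so does the branching sum itself almost surely.
\<close>

lemma moment_Suc_eq_0:
  assumes "rho M N C 1 = 0"
  shows "moment (Suc n) \<gamma> = 0"
proof -
  have [measurable]: "(\<lambda>\<omega>. tree_sum (Suc n) (family \<omega>)) \<in> borel_measurable M"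
    by (rule measurable_compose[OF measurable_family measurable_tree_sum])
  have "moment (Suc n) 1 = 0"
    using moment_Suc_1[of n] assms by simp
  then show ?thesis
    unfolding moment_def by (simp add: nn_integral_0_iff_AE del: tree_sum.simps)
qed

end

theorem lemma4p3:
  fixes M :: "'a measure"
    and Q :: "nat list \<Rightarrow> 'a \<Rightarrow> real"
    and N :: "nat list \<Rightarrow> 'a \<Rightarrow> enat"
    and C :: "nat list \<Rightarrow> 'a \<Rightarrow> real"
    and \<beta> :: real
  assumes "weighted_branching M Q N C"
    and "measure M {\<omega> \<in> space M. Q [] \<omega> > 0} > 0"
    and "\<beta> > 1"
    and "(\<integral>\<^sup>+\<omega>. ennreal (Q [] \<omega> powr \<beta>) \<partial>M) < \<infinity>"
    and "(\<integral>\<^sup>+\<omega>. ennreal_powr (\<Sum>\<^sub>\<infinity>i\<in>upto_enat (N [] \<omega>). ennreal (C [i] \<omega>)) \<beta> \<partial>M) < \<infinity>"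
    and "max (rho M N C 1) (rho M N C \<beta>) < 1"
  shows "\<exists>K::real. K > 0 \<and> (\<forall>n::nat.
    (\<integral>\<^sup>+\<omega>. ennreal_powr (branching_sum Q N C n \<omega>) \<beta> \<partial>M)
      \<le> ennreal K * max (rho M N C 1) (rho M N C \<beta>) ^ n)"
proof -
  interpret weighted_branching M Q N C by fact
  obtain r where r: "max (rho M N C 1) (rho M N C \<beta>) = ennreal r" "0 \<le> r"
    using assms(6) by (cases "max (rho M N C 1) (rho M N C \<beta>)") auto
  then have r_less: "r < 1" using assms(6) by (simp flip: ennreal_1 add: ennreal_less_iff)
  have Q: "moment 0 \<beta> < \<top>" using assms(4) by (simp add: moment_0)
  have C: "(\<integral>\<^sup>+\<omega>. ennreal_powr (\<Sum>j. root_weight j \<omega>) \<beta> \<partial>M) < \<top>"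
    using assms(5) by (simp add: infsum_children_eq)
  have "\<exists>K\<ge>0. \<forall>n. moment n \<beta> \<le> ennreal (K * r ^ n)"
  proof (cases "r = 0")
    case True
    obtain K where K: "moment 0 \<beta> = ennreal K" "0 \<le> K"
      using Q by (cases "moment 0 \<beta>") auto
    have "rho M N C 1 = 0" using r(1) True by (simp add: max_def split: if_splits)
    then have "moment n \<beta> \<le> ennreal (K * r ^ n)" for n
      by (cases n) (simp_all add: K moment_Suc_eq_0)
    then show ?thesis using K by blast
  next
    case False
    then show ?thesis
      using moment_geometric_decay[OF assms(3) Q C r(1) _ r_less, of \<beta>] r(2) assms(3) by simp
  qed
  then obtain K where K: "0 \<le> K" "\<And>n. moment n \<beta> \<le> ennreal (K * r ^ n)"
    by blast
  show ?thesis
  proof (intro exI[of _ "K + 1"] conjI allI)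
    fix n
    have "moment n \<beta> \<le> ennreal (K * r ^ n)" by (rule K(2))
    also have "\<dots> \<le> ennreal ((K + 1) * r ^ n)"
      using r(2) by (intro ennreal_leI mult_right_mono) auto
    also have "\<dots> = ennreal (K + 1) * max (rho M N C 1) (rho M N C \<beta>) ^ n"
      using r K(1) by (simp add: ennreal_mult ennreal_power)
    finally show "(\<integral>\<^sup>+\<omega>. ennreal_powr (branching_sum Q N C n \<omega>) \<beta> \<partial>M)
      \<le> ennreal (K + 1) * max (rho M N C 1) (rho M N C \<beta>) ^ n"
      by (simp only: nn_integral_branching_sum_powr)
  qed (use K in simp)
qed

end
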